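(* Fix real numbers $c<d$. The topological dimension of each of the spaces $\mathrm{(ffid^{[c,d]})}$, $\mathrm{(ffid)}$, $\mathrm{(fid)}$, $\mathrm{(cfid)}$, $\mathrm{(cid)}$, $\mathrm{(pfd)}$, $\mathrm{(rid)}$, with the topology induced by the interleaving distance, is infinite.
   Context: Fix a field $\mathbf{k}$. A persistence module is a functor $M:(\mathbb{R},\le)\to \mathrm{Vect}_{\mathbf{k}}$; "persistence module" means isomorphism class. For an interval $J\subset\mathbb{R}$, the interval module $J$ is $\mathbf{k}$ at points of $J$ and $0$ elsewhere, with identity maps between points of $J$ and zero maps otherwise. For $\varepsilon\ge 0$, $M,N$ are $\varepsilon$-interleaved if there are families of linear maps $\varphi_a:M(a)\to N(a+\varepsilon)$ and $\psi_a:N(a)\to M(a+\varepsilon)$, natural in $a\in\mathbb{R}$, with $\psi_{a+\varepsilon}\varphi_a=M(a\le a+2\varepsilon)$ and $\varphi_{a+\varepsilon}\psi_a=N(a\le a+2\varepsilon)$ for all $a$. The interleaving distance is $d_I(M,N)=\inf\{\varepsilon\ge0 : M,N \text{ are } \varepsilon\text{-interleaved}\}$ ($\infty$ if there is none). It is an extended pseudometric; the induced topology has the open balls $B_r(M)=\{N: d_I(M,N)<r\}$, $r>0$, as a base. Sets of persistence modules: $\mathrm{(fid)}$: finite direct sums of interval modules (including the zero module); $\mathrm{(ffid)}$: those in $\mathrm{(fid)}$ with all intervals finite (bounded); $\mathrm{(ffid^{[c,d]})}$: those in $\mathrm{(ffid)}$ with all intervals contained in $[c,d]$; $\mathrm{(cid)}$: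 direct sums of countably many interval modules; $\mathrm{(cfid)}$: those in $\mathrm{(cid)}$ with all intervals finite (bounded); $\mathrm{(pfd)}$: persistence modules $M$ with every $M(a)$ finite dimensional; $\mathrm{(rid)}$: direct sums $\bigoplus_{\alpha\in A}I_\alpha$ of interval modules with $|A|\le|\mathbb{R}|$. A collection of subsets of $X$ has order $m$ if some point of $X$ lies in $m$ of the subsets but no point lies in $m+1$ of them. A refinement of an open cover $\mathcal{O}$ is an open cover $\mathcal{V}$ each of whose members is contained in a member of $\mathcal{O}$. The topological dimension (Lebesgue covering dimension) of $X$ is the smallest $m$ such that every open cover of $X$ has a refinement with order $m+1$, and is infinite if there is no such $m$. *)

theory Defs
  imports "HOL-Analysis.Analysis" "HOL-Library.Poly_Mapping" "HOL-Library.Extended_Nat"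
begin

section \<open>Persistence modules\<close>

text \<open>
  The vector spaces \<open>fiber M a\<close> are subspaces of an ambient \<open>'k\<close>-vector space carried by the
  type \<open>'v\<close>. The structure maps \<open>tmap M a b\<close> are only meaningful for \<open>a \<le> b\<close> and on
  \<open>fiber M a\<close>; nothing below depends on their other values.
\<close>

record ('k, 'v) pmod =
  scal :: "'k \<Rightarrow> 'v \<Rightarrow> 'v"
  fiber :: "real \<Rightarrow> 'v set"
  tmap :: "real \<Rightarrow> real \<Rightarrow> 'v \<Rightarrow> 'v"

definition linear_between ::
  "('k \<Rightarrow> 'v \<Rightarrow> 'v) \<Rightarrow> 'v set \<Rightarrow> ('k \<Rightarrow> 'w \<Rightarrow> 'w) \<Rightarrow> 'w set \<Rightarrow> ('v::plus \<Rightarrow> 'w::plus) \<Rightarrow> bool"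
where
  "linear_between s V t W f \<longleftrightarrow>
     f ` V \<subseteq> W \<and>
     (\<forall>x\<in>V. \<forall>y\<in>V. f (x + y) = f x + f y) \<and>
     (\<forall>c. \<forall>x\<in>V. f (s c x) = t c (f x))"

definition persistence_module :: "('k::field, 'v::ab_group_add) pmod \<Rightarrow> bool" where
  "persistence_module M \<longleftrightarrow>
     vector_space (scal M) \<and>
     (\<forall>a. module.subspace (scal M) (fiber M a)) \<and>
     (\<forall>a b. a \<le> b \<longrightarrow> linear_between (scal M) (fiber M a) (scal M) (fiber M b) (tmap M a b)) \<and>
     (\<forall>a. \<forall>x\<in>fiber M a. tmap M a a x = x) \<and>
     (\<forall>a b c. a \<le> b \<longrightarrow> b \<le> c \<longrightarrow> (\<forall>x\<in>fiber M a. tmap M b c (tmap M a b x) = tmap M a c x))"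

text \<open>
  Natural families of linear maps \<open>M(a) \<rightarrow> N(a + \<epsilon>)\<close>; ordinary morphisms are the case \<open>\<epsilon> = 0\<close>.
\<close>

definition shift_morphism ::
  "real \<Rightarrow> ('k, 'v::plus) pmod \<Rightarrow> ('k, 'w::plus) pmod \<Rightarrow> (real \<Rightarrow> 'v \<Rightarrow> 'w) \<Rightarrow> bool"
where
  "shift_morphism \<epsilon> M N \<phi> \<longleftrightarrow>
     (\<forall>a. linear_between (scal M) (fiber M a) (scal N) (fiber N (a + \<epsilon>)) (\<phi> a)) \<and>
     (\<forall>a b. a \<le> b \<longrightarrow>
        (\<forall>x\<in>fiber M a. \<phi> b (tmap M a b x) = tmap N (a + \<epsilon>) (b + \<epsilon>) (\<phi> a x)))"

definition pmod_iso :: "('k, 'v::plus) pmod \<Rightarrow> ('k, 'w::plus) pmod \<Rightarrow> bool" where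
  "pmod_iso M N \<longleftrightarrow>
     (\<exists>\<phi>. shift_morphism 0 M N \<phi> \<and> (\<forall>a. bij_betw (\<phi> a) (fiber M a) (fiber N a)))"

definition interleaved :: "real \<Rightarrow> ('k, 'v::plus) pmod \<Rightarrow> ('k, 'w::plus) pmod \<Rightarrow> bool" where
  "interleaved \<epsilon> M N \<longleftrightarrow>
     (\<exists>\<phi> \<psi>. shift_morphism \<epsilon> M N \<phi> \<and> shift_morphism \<epsilon> N M \<psi> \<and>
        (\<forall>a. \<forall>x\<in>fiber M a. \<psi> (a + \<epsilon>) (\<phi> a x) = tmap M a (a + 2 * \<epsilon>) x) \<and>
        (\<forall>a. \<forall>y\<in>fiber N a. \<phi> (a + \<epsilon>) (\<psi> a y) = tmap N a (a + 2 * \<epsilon>) y))"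

definition interleaving_dist :: "('k, 'v::plus) pmod \<Rightarrow> ('k, 'w::plus) pmod \<Rightarrow> ennreal" where
  "interleaving_dist M N = (INF \<epsilon>\<in>{\<epsilon>. 0 \<le> \<epsilon> \<and> interleaved \<epsilon> M N}. ennreal \<epsilon>)"

definition pointwise_finite_dim :: "('k::field, 'v::ab_group_add) pmod \<Rightarrow> bool" where
  "pointwise_finite_dim M \<longleftrightarrow> (\<forall>a. \<exists>B. finite B \<and> module.span (scal M) B = fiber M a)"

definition interval_module :: "real set \<Rightarrow> ('k::field, 'k) pmod" where
  "interval_module J =
     \<lparr>scal = (*),
      fiber = (\<lambda>a. if a \<in> J then UNIV else {0}),
      tmap = (\<lambda>a b x. if a \<in> J \<and> b \<in> J then x else 0)\<rparr>"

definition direct_sum :: "'i set \<Rightarrow> ('i \<Rightarrow> ('k, 'v::zero) pmod) \<Rightarrow> ('k, 'i \<Rightarrow>\<^sub>0 'v) pmod" where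
  "direct_sum A M =
     \<lparr>scal = (\<lambda>c. Poly_Mapping.mapp (\<lambda>i. scal (M i) c)),
      fiber = (\<lambda>a. {f. Poly_Mapping.keys f \<subseteq> A \<and>
                       (\<forall>i\<in>A. Poly_Mapping.lookup f i \<in> fiber (M i) a)}),
      tmap = (\<lambda>a b. Poly_Mapping.mapp (\<lambda>i. tmap (M i) a b))\<rparr>"

lemma linear_between_comp:
  "linear_between s U t V f \<Longrightarrow> linear_between t V u W g \<Longrightarrow> linear_between s U u W (\<lambda>x. g (f x))"
  unfolding linear_between_def by (auto simp: image_subset_iff)

lemma persistence_module_direct_sum:
  assumes "\<And>i. persistence_module (M i)"
  shows "persistence_module (direct_sum A M)"
proof -
  have vs: "vector_space (scal (M i))" for i
    using assms by (simp add: persistence_module_def)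
  then have md: "module (scal (M i))" for i
    by (simp add: module_iff_vector_space)
  have z: "scal (M i) c 0 = 0" for i c
    by (rule module.scale_zero_right[OF md])
  have sub: "module.subspace (scal (M i)) (fiber (M i) a)" for i a
    using assms by (simp add: persistence_module_def)
  have lin: "linear_between (scal (M i)) (fiber (M i) a) (scal (M i)) (fiber (M i) b) (tmap (M i) a b)"
    if "a \<le> b" for i a b
    using assms that by (simp add: persistence_module_def)
  have z2: "tmap (M i) a b 0 = 0" if "a \<le> b" for i a b
  proof -
    have "tmap (M i) a b (0 + 0) = tmap (M i) a b 0 + tmap (M i) a b 0"
      using lin[OF that, of i] module.subspace_0[OF md sub, of i a] unfolding linear_between_def by blast
    then show ?thesis by simp
  qed
  have ls: "Poly_Mapping.lookup (scal (direct_sum A M) c f) i = scal (M i) c (Poly_Mapping.lookup f i)" for c f i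
    by (simp add: direct_sum_def lookup_mapp when_def z in_keys_iff)
  have lt: "Poly_Mapping.lookup (tmap (direct_sum A M) a b f) i = tmap (M i) a b (Poly_Mapping.lookup f i)"
    if "a \<le> b" for a b f i
    using z2[OF that] by (simp add: direct_sum_def lookup_mapp when_def in_keys_iff)
  have fib: "f \<in> fiber (direct_sum A M) a \<longleftrightarrow>
      (\<forall>i. (i \<in> A \<longrightarrow> Poly_Mapping.lookup f i \<in> fiber (M i) a) \<and> (i \<notin> A \<longrightarrow> Poly_Mapping.lookup f i = 0))" for f a
    by (auto simp: direct_sum_def in_keys_iff)
  have V: "vector_space (scal (direct_sum A M))"
    by unfold_locales
      (auto intro!: poly_mapping_eqI simp: ls lookup_add module.scale_right_distrib[OF md]
        module.scale_left_distrib[OF md] module.scale_scale[OF md] module.scale_one[OF md])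
  then have Md: "module (scal (direct_sum A M))"
    by (simp add: module_iff_vector_space)
  have S: "module.subspace (scal (direct_sum A M)) (fiber (direct_sum A M) a)" for a
    using sub unfolding module.subspace_def[OF Md] module.subspace_def[OF md]
    by (auto simp: fib ls lookup_add z)
  have L: "linear_between (scal (direct_sum A M)) (fiber (direct_sum A M) a)
      (scal (direct_sum A M)) (fiber (direct_sum A M) b) (tmap (direct_sum A M) a b)" if "a \<le> b" for a b
  proof -
    have 1: "tmap (M i) a b x \<in> fiber (M i) b" if "x \<in> fiber (M i) a" for i x
      using lin[OF \<open>a \<le> b\<close>, of i] that unfolding linear_between_def by blast
    have 2: "tmap (M i) a b (x + y) = tmap (M i) a b x + tmap (M i) a b y"
      if "x \<in> fiber (M i) a" "y \<in> fiber (M i) a" for i x y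
      using lin[OF \<open>a \<le> b\<close>, of i] that unfolding linear_between_def by blast
    have 3: "tmap (M i) a b (scal (M i) c x) = scal (M i) c (tmap (M i) a b x)"
      if "x \<in> fiber (M i) a" for i c x
      using lin[OF \<open>a \<le> b\<close>, of i] that unfolding linear_between_def by blast
    show ?thesis
      unfolding linear_between_def
    proof (intro conjI ballI allI)
      show "tmap (direct_sum A M) a b ` fiber (direct_sum A M) a \<subseteq> fiber (direct_sum A M) b"
        by (auto simp: fib lt[OF that] 1 z2[OF that])
    next
      fix f g assume fg: "f \<in> fiber (direct_sum A M) a" "g \<in> fiber (direct_sum A M) a"
      show "tmap (direct_sum A M) a b (f + g)
          = tmap (direct_sum A M) a b f + tmap (direct_sum A M) a b g"
      proof (intro poly_mapping_eqI)
        fix i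
        show "Poly_Mapping.lookup (tmap (direct_sum A M) a b (f + g)) i
            = Poly_Mapping.lookup (tmap (direct_sum A M) a b f + tmap (direct_sum A M) a b g) i"
          using fg unfolding fib lookup_add lt[OF that]
          by (cases "i \<in> A") (simp_all add: 2 z2[OF that])
      qed
    next
      fix c f assume f: "f \<in> fiber (direct_sum A M) a"
      show "tmap (direct_sum A M) a b (scal (direct_sum A M) c f)
          = scal (direct_sum A M) c (tmap (direct_sum A M) a b f)"
      proof (intro poly_mapping_eqI)
        fix i
        show "Poly_Mapping.lookup (tmap (direct_sum A M) a b (scal (direct_sum A M) c f)) i
            = Poly_Mapping.lookup (scal (direct_sum A M) c (tmap (direct_sum A M) a b f)) i"
          using f unfolding fib ls lt[OF that]
          by (cases "i \<in> A") (simp_all add: 3 z z2[OF that])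
      qed
    qed
  qed
  have I: "tmap (direct_sum A M) a a f = f" if "f \<in> fiber (direct_sum A M) a" for a f
  proof (rule poly_mapping_eqI)
    fix i
    have "tmap (M i) a a x = x" if "x \<in> fiber (M i) a" for x
      using assms that by (simp add: persistence_module_def)
    then show "Poly_Mapping.lookup (tmap (direct_sum A M) a a f) i = Poly_Mapping.lookup f i"
      using that unfolding fib by (cases "i \<in> A") (auto simp: lt z2)
  qed
  have C: "tmap (direct_sum A M) b c (tmap (direct_sum A M) a b f) = tmap (direct_sum A M) a c f"
    if "f \<in> fiber (direct_sum A M) a" "a \<le> b" "b \<le> c" for a b c f
  proof (rule poly_mapping_eqI)
    fix i
    have "tmap (M i) b c (tmap (M i) a b x) = tmap (M i) a c x" if "x \<in> fiber (M i) a" for x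
      using assms[of i] that \<open>a \<le> b\<close> \<open>b \<le> c\<close> unfolding persistence_module_def by blast
    then show "Poly_Mapping.lookup (tmap (direct_sum A M) b c (tmap (direct_sum A M) a b f)) i
        = Poly_Mapping.lookup (tmap (direct_sum A M) a c f) i"
      using that unfolding fib by (cases "i \<in> A") (auto simp: lt z2)
  qed
  show ?thesis
    unfolding persistence_module_def using V S L I C by blast
qed

lemma persistence_module_interval_module:
  assumes "is_interval J"
  shows "persistence_module (interval_module J)" (is "persistence_module ?I")
proof -
  have V: "vector_space ((*) :: 'a \<Rightarrow> 'a \<Rightarrow> 'a::field)"
    by unfold_locales (auto simp: algebra_simps)
  then have m: "module ((*) :: 'a \<Rightarrow> 'a \<Rightarrow> 'a::field)"
    by (simp add: module_iff_vector_space)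
  have conv: "b \<in> J" if "a \<in> J" "c \<in> J" "a \<le> b" "b \<le> c" for a b c
    using assms that mem_is_interval_1_I by blast
  have comp: "tmap ?I b c (tmap ?I a b x) = tmap ?I a c x" if "a \<le> b" "b \<le> c" for a b c x
    using conv[OF _ _ that] by (auto simp: interval_module_def)
  have "\<forall>a. module.subspace (scal ?I) (fiber ?I a)"
    using m by (simp add: interval_module_def module.subspace_UNIV module.subspace_single_0)
  moreover have "\<forall>a b. linear_between (scal ?I) (fiber ?I a) (scal ?I) (fiber ?I b) (tmap ?I a b)"
    by (auto simp: interval_module_def linear_between_def)
  moreover have "\<forall>a. \<forall>x\<in>fiber ?I a. tmap ?I a a x = x"
    by (simp add: interval_module_def)
  ultimately show ?thesis
    using V comp unfolding persistence_module_def by (simp add: interval_module_def)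
qed

lemma shift_morphism_mem:
  "shift_morphism \<epsilon> M N \<phi> \<Longrightarrow> x \<in> fiber M a \<Longrightarrow> \<phi> a x \<in> fiber N (a + \<epsilon>)"
  unfolding shift_morphism_def linear_between_def by blast

lemma shift_morphism_comp:
  assumes "shift_morphism \<epsilon> M N \<phi>" "shift_morphism \<delta> N P \<psi>"
  shows "shift_morphism (\<epsilon> + \<delta>) M P (\<lambda>a x. \<psi> (a + \<epsilon>) (\<phi> a x))"
  unfolding shift_morphism_def
proof (intro conjI allI impI ballI)
  fix a
  have 1: "linear_between (scal M) (fiber M a) (scal N) (fiber N (a + \<epsilon>)) (\<phi> a)"
    using assms(1) by (simp add: shift_morphism_def)
  have 2: "linear_between (scal N) (fiber N (a + \<epsilon>)) (scal P) (fiber P (a + \<epsilon> + \<delta>)) (\<psi> (a + \<epsilon>))"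
    using assms(2) unfolding shift_morphism_def by blast
  show "linear_between (scal M) (fiber M a) (scal P) (fiber P (a + (\<epsilon> + \<delta>)))
         (\<lambda>x. \<psi> (a + \<epsilon>) (\<phi> a x))"
    using linear_between_comp[OF 1 2] by (simp add: add.assoc)
next
  fix a b :: real and x assume ab: "a \<le> b" and x: "x \<in> fiber M a"
  have "\<phi> b (tmap M a b x) = tmap N (a + \<epsilon>) (b + \<epsilon>) (\<phi> a x)"
    using assms(1) ab x unfolding shift_morphism_def by blast
  moreover have "\<psi> (b + \<epsilon>) (tmap N (a + \<epsilon>) (b + \<epsilon>) (\<phi> a x))
      = tmap P (a + \<epsilon> + \<delta>) (b + \<epsilon> + \<delta>) (\<psi> (a + \<epsilon>) (\<phi> a x))"
    using assms(2) ab shift_morphism_mem[OF assms(1) x] unfolding shift_morphism_def by force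
  ultimately show "\<psi> (b + \<epsilon>) (\<phi> b (tmap M a b x))
      = tmap P (a + (\<epsilon> + \<delta>)) (b + (\<epsilon> + \<delta>)) (\<psi> (a + \<epsilon>) (\<phi> a x))"
    by (simp add: add.assoc)
qed

lemma interleaving_comp_aux:
  assumes M: "persistence_module M" and nn: "0 \<le> \<epsilon>" "0 \<le> \<delta>"
    and f: "shift_morphism \<epsilon> M N f" "shift_morphism \<epsilon> N M g"
    and gf: "\<forall>a. \<forall>x\<in>fiber M a. g (a + \<epsilon>) (f a x) = tmap M a (a + 2 * \<epsilon>) x"
    and h: "shift_morphism \<delta> N P h" "shift_morphism \<delta> P N k"
    and kh: "\<forall>a. \<forall>x\<in>fiber N a. k (a + \<delta>) (h a x) = tmap N a (a + 2 * \<delta>) x"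
    and x: "x \<in> fiber M a"
  shows "g (a + (\<epsilon> + \<delta>) + \<delta>) (k (a + (\<epsilon> + \<delta>)) (h (a + \<epsilon>) (f a x))) = tmap M a (a + 2 * (\<epsilon> + \<delta>)) x"
proof -
  have fx: "f a x \<in> fiber N (a + \<epsilon>)"
    by (rule shift_morphism_mem[OF f(1) x])
  have "k (a + \<epsilon> + \<delta>) (h (a + \<epsilon>) (f a x)) = tmap N (a + \<epsilon>) (a + \<epsilon> + 2 * \<delta>) (f a x)"
    using kh fx by blast
  moreover have "g (a + \<epsilon> + 2 * \<delta>) (tmap N (a + \<epsilon>) (a + \<epsilon> + 2 * \<delta>) (f a x))
      = tmap M (a + \<epsilon> + \<epsilon>) (a + \<epsilon> + 2 * \<delta> + \<epsilon>) (g (a + \<epsilon>) (f a x))"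
  proof -
    have "a + \<epsilon> \<le> a + \<epsilon> + 2 * \<delta>" using nn by simp
    then show ?thesis using f(2) fx unfolding shift_morphism_def by blast
  qed
  moreover have "g (a + \<epsilon>) (f a x) = tmap M a (a + 2 * \<epsilon>) x"
    using gf x by blast
  moreover have "tmap M (a + 2 * \<epsilon>) (a + 2 * (\<epsilon> + \<delta>)) (tmap M a (a + 2 * \<epsilon>) x) = tmap M a (a + 2 * (\<epsilon> + \<delta>)) x"
  proof -
    have "a \<le> a + 2 * \<epsilon>" "a + 2 * \<epsilon> \<le> a + 2 * (\<epsilon> + \<delta>)" using nn by simp_all
    then show ?thesis using M x unfolding persistence_module_def by blast
  qed
  moreover have "a + \<epsilon> + \<epsilon> = a + 2 * \<epsilon>" "a + \<epsilon> + 2 * \<delta> + \<epsilon> = a + 2 * (\<epsilon> + \<delta>)"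
    "a + (\<epsilon> + \<delta>) + \<delta> = a + \<epsilon> + 2 * \<delta>" "a + (\<epsilon> + \<delta>) = a + \<epsilon> + \<delta>" by simp_all
  ultimately show ?thesis by metis
qed

lemma interleaved_trans:
  assumes M: "persistence_module M" and P: "persistence_module P"
    and nn: "0 \<le> \<epsilon>" "0 \<le> \<delta>" and MN: "interleaved \<epsilon> M N" and NP: "interleaved \<delta> N P"
  shows "interleaved (\<epsilon> + \<delta>) M P"
proof -
  obtain f g where f: "shift_morphism \<epsilon> M N f" "shift_morphism \<epsilon> N M g"
    and gf: "\<forall>a. \<forall>x\<in>fiber M a. g (a + \<epsilon>) (f a x) = tmap M a (a + 2 * \<epsilon>) x"
    and fg: "\<forall>a. \<forall>x\<in>fiber N a. f (a + \<epsilon>) (g a x) = tmap N a (a + 2 * \<epsilon>) x"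
    using MN unfolding interleaved_def by blast
  obtain h k where h: "shift_morphism \<delta> N P h" "shift_morphism \<delta> P N k"
    and kh: "\<forall>a. \<forall>x\<in>fiber N a. k (a + \<delta>) (h a x) = tmap N a (a + 2 * \<delta>) x"
    and hk: "\<forall>a. \<forall>x\<in>fiber P a. h (a + \<delta>) (k a x) = tmap P a (a + 2 * \<delta>) x"
    using NP unfolding interleaved_def by blast
  have "shift_morphism (\<epsilon> + \<delta>) M P (\<lambda>a x. h (a + \<epsilon>) (f a x))"
    by (rule shift_morphism_comp[OF f(1) h(1)])
  moreover have "shift_morphism (\<epsilon> + \<delta>) P M (\<lambda>a x. g (a + \<delta>) (k a x))"
    using shift_morphism_comp[OF h(2) f(2)] by (simp add: add.commute)
  moreover have "g (a + (\<epsilon> + \<delta>) + \<delta>) (k (a + (\<epsilon> + \<delta>)) (h (a + \<epsilon>) (f a x))) = tmap M a (a + 2 * (\<epsilon> + \<delta>)) x"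
    if "x \<in> fiber M a" for a x
    by (rule interleaving_comp_aux[OF M nn f gf h kh that])
  moreover have "h (a + (\<epsilon> + \<delta>) + \<epsilon>) (f (a + (\<epsilon> + \<delta>)) (g (a + \<delta>) (k a x))) = tmap P a (a + 2 * (\<epsilon> + \<delta>)) x"
    if "x \<in> fiber P a" for a x
    using interleaving_comp_aux[OF P nn(2) nn(1) h(2) h(1) hk f(2) f(1) fg that]
    by (simp add: add.commute)
  ultimately show ?thesis
    unfolding interleaved_def by blast
qed

lemma interleaved_sym: "interleaved \<epsilon> M N \<Longrightarrow> interleaved \<epsilon> N M"
  unfolding interleaved_def by blast

lemma pmod_iso_imp_interleaved:
  assumes M: "persistence_module M" and N: "persistence_module N" and "pmod_iso M N"
  shows "interleaved 0 M N"
proof -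
  obtain f where f: "shift_morphism 0 M N f" and bij: "\<And>a. bij_betw (f a) (fiber M a) (fiber N a)"
    using assms(3) unfolding pmod_iso_def by blast
  define g where "g a = inv_into (fiber M a) (f a)" for a
  have gm: "g a y \<in> fiber M a" and fg: "f a (g a y) = y" if "y \<in> fiber N a" for a y
    using bij_betw_inv_into[OF bij[of a]] bij_betw_inv_into_right[OF bij[of a]] that
    by (auto simp: g_def bij_betw_def)
  have gf: "g a (f a x) = x" if "x \<in> fiber M a" for a x
    using bij_betw_inv_into_left[OF bij[of a]] that by (simp add: g_def)
  have lin: "linear_between (scal M) (fiber M a) (scal N) (fiber N a) (f a)" for a
    using f unfolding shift_morphism_def by force
  have md: "module (scal M)" and sub: "module.subspace (scal M) (fiber M a)" for a
    using M by (auto simp: persistence_module_def module_iff_vector_space)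
  have "linear_between (scal N) (fiber N a) (scal M) (fiber M a) (g a)" for a
    unfolding linear_between_def
  proof (intro conjI ballI allI)
    show "g a ` fiber N a \<subseteq> fiber M a" using gm by blast
  next
    fix x y assume xy: "x \<in> fiber N a" "y \<in> fiber N a"
    then have "f a (g a x + g a y) = x + y"
      using lin[of a] gm fg unfolding linear_between_def by metis
    then show "g a (x + y) = g a x + g a y"
      using gf module.subspace_add[OF md sub] gm xy by metis
  next
    fix c x assume x: "x \<in> fiber N a"
    then have "f a (scal M c (g a x)) = scal N c x"
      using lin[of a] gm fg unfolding linear_between_def by metis
    then show "g a (scal N c x) = scal M c (g a x)"
      using gf module.subspace_scale[OF md sub] gm x by metis
  qed
  moreover have "g b (tmap N a b y) = tmap M a b (g a y)" if "a \<le> b" "y \<in> fiber N a" for a b y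
  proof -
    have "f b (tmap M a b (g a y)) = tmap N a b (f a (g a y))"
      using f that gm[OF that(2)] unfolding shift_morphism_def by force
    moreover have "tmap M a b (g a y) \<in> fiber M b"
      using M that gm[OF that(2)] unfolding persistence_module_def linear_between_def by blast
    ultimately show ?thesis using fg gf that by metis
  qed
  ultimately have "shift_morphism 0 N M g"
    unfolding shift_morphism_def by simp
  moreover have "tmap M a a x = x" if "x \<in> fiber M a" for a x
    using M that unfolding persistence_module_def by blast
  moreover have "tmap N a a x = x" if "x \<in> fiber N a" for a x
    using N that unfolding persistence_module_def by blast
  ultimately show ?thesis
    unfolding interleaved_def using f gf fg by (intro exI[of _ f] exI[of _ g]) simp
qed

lemma pmod_iso_refl: "pmod_iso M M"
proof -
  have "shift_morphism 0 M M (\<lambda>a x. x)"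
    by (simp add: shift_morphism_def linear_between_def)
  then show ?thesis
    unfolding pmod_iso_def by (intro exI[of _ "\<lambda>a x. x"]) (simp add: bij_betw_def)
qed

lemma interleaving_dist_triangle:
  assumes "persistence_module M" "persistence_module P"
  shows "interleaving_dist M P \<le> interleaving_dist M N + interleaving_dist N P"
proof -
  let ?S = "\<lambda>M N. {\<epsilon>. 0 \<le> \<epsilon> \<and> interleaved \<epsilon> M N}"
  have "interleaving_dist M P \<le> ennreal \<epsilon> + ennreal \<delta>" if "\<epsilon> \<in> ?S M N" "\<delta> \<in> ?S N P" for \<epsilon> \<delta>
  proof -
    have "\<epsilon> + \<delta> \<in> ?S M P" using that interleaved_trans[OF assms, of \<epsilon> \<delta> N] by simp
    then have "interleaving_dist M P \<le> ennreal (\<epsilon> + \<delta>)"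
      unfolding interleaving_dist_def by (rule INF_lower)
    then show ?thesis using that by (simp add: ennreal_plus)
  qed
  note sum = this
  show ?thesis
  proof (rule ennreal_le_epsilon)
    fix e :: real
    assume fin: "interleaving_dist M N + interleaving_dist N P < top" and e: "0 < e"
    have half: "x < x + ennreal (e / 2)" if "x < top" for x
      using that e by (cases x) (auto simp flip: ennreal_plus simp: ennreal_less_iff)
    have "interleaving_dist M N < interleaving_dist M N + ennreal (e / 2)"
      "interleaving_dist N P < interleaving_dist N P + ennreal (e / 2)"
      using fin e by (auto intro!: half)
    then obtain \<epsilon> \<delta> where "\<epsilon> \<in> ?S M N" "\<delta> \<in> ?S N P"
      and le: "ennreal \<epsilon> < interleaving_dist M N + ennreal (e / 2)"
        "ennreal \<delta> < interleaving_dist N P + ennreal (e / 2)"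
      unfolding interleaving_dist_def INF_less_iff by blast
    then have "interleaving_dist M P \<le> ennreal \<epsilon> + ennreal \<delta>"
      using sum by blast
    also have "\<dots> \<le> (interleaving_dist M N + ennreal (e / 2)) + (interleaving_dist N P + ennreal (e / 2))"
      using le by (intro add_mono) auto
    also have "\<dots> = interleaving_dist M N + interleaving_dist N P + (ennreal (e / 2) + ennreal (e / 2))"
      by (simp add: ac_simps)
    also have "ennreal (e / 2) + ennreal (e / 2) = ennreal e"
      using e by (simp flip: ennreal_plus)
    finally show "interleaving_dist M P \<le> interleaving_dist M N + interleaving_dist N P + ennreal e" .
  qed
qed

lemma interleaving_dist_sym: "interleaving_dist M N = interleaving_dist N M"
proof -
  have "interleaved \<epsilon> M N = interleaved \<epsilon> N M" for \<epsilon>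
    by (rule iffI; erule interleaved_sym)
  then show ?thesis by (simp add: interleaving_dist_def)
qed

lemma pmod_iso_imp_interleaving_dist_0:
  assumes "persistence_module M" "persistence_module N" "pmod_iso M N"
  shows "interleaving_dist M N = 0"
proof -
  have "interleaving_dist M N \<le> ennreal 0"
    unfolding interleaving_dist_def
    by (rule INF_lower) (use pmod_iso_imp_interleaved[OF assms] in simp)
  then show ?thesis by simp
qed


section \<open>Isomorphism classes and the interleaving topology\<close>

text \<open>
  The ambient type of representatives is \<open>real \<Rightarrow>\<^sub>0 'k\<close>, the free vector space on \<open>\<real>\<close> (with the
  usual scaling, or any other that makes it a vector space). Every pointwise finite-dimensional
  persistence module, and every direct sum of at most continuum many interval modules, is isomorphic
  to one with this ambient type, so no isomorphism class of the sets below is lost.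
\<close>

type_synonym 'k pclass = "('k, real \<Rightarrow>\<^sub>0 'k) pmod set"

definition iso_class :: "('k::field, real \<Rightarrow>\<^sub>0 'k) pmod \<Rightarrow> 'k pclass" where
  "iso_class M = {N. persistence_module N \<and> pmod_iso M N}"

text \<open>
  The infimum is over representatives, on which the distance does not depend (see
  \<open>class_dist_iso_class\<close>).
\<close>

definition class_dist :: "('k::field) pclass \<Rightarrow> 'k pclass \<Rightarrow> ennreal" where
  "class_dist P Q = (INF M\<in>P. INF N\<in>Q. interleaving_dist M N)"

lemma class_dist_iso_class:
  assumes M: "persistence_module M" and N: "persistence_module N"
  shows "class_dist (iso_class M) (iso_class N) = interleaving_dist M N"
proof (rule antisym)
  have "M \<in> iso_class M" "N \<in> iso_class N"
    using assms pmod_iso_refl by (auto simp: iso_class_def)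
  then show "class_dist (iso_class M) (iso_class N) \<le> interleaving_dist M N"
    unfolding class_dist_def by (meson INF_lower2 order_refl)
  have "interleaving_dist M N \<le> interleaving_dist M' N'"
    if "M' \<in> iso_class M" "N' \<in> iso_class N" for M' N'
  proof -
    have M': "persistence_module M'" "pmod_iso M M'" and N': "persistence_module N'" "pmod_iso N N'"
      using that by (auto simp: iso_class_def)
    have "interleaving_dist M N \<le> interleaving_dist M M' + interleaving_dist M' N"
      by (rule interleaving_dist_triangle[OF M N])
    also have "interleaving_dist M' N \<le> interleaving_dist M' N' + interleaving_dist N' N"
      by (rule interleaving_dist_triangle[OF M'(1) N])
    finally show ?thesis
      using pmod_iso_imp_interleaving_dist_0[OF M M'] pmod_iso_imp_interleaving_dist_0[OF N N']
      by (simp add: interleaving_dist_sym[of N' N] add_mono)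
  qed
  then show "interleaving_dist M N \<le> class_dist (iso_class M) (iso_class N)"
    unfolding class_dist_def by (intro INF_greatest)
qed

definition class_ball :: "('k::field) pclass set \<Rightarrow> 'k pclass \<Rightarrow> real \<Rightarrow> 'k pclass set" where
  "class_ball X P r = {Q \<in> X. class_dist P Q < ennreal r}"

text \<open>
  On sets of isomorphism classes the balls are a base, not just a subbase, of this topology (see
  \<open>openin_interleaving_topology\<close>).
\<close>

definition interleaving_topology :: "('k::field) pclass set \<Rightarrow> 'k pclass topology" where
  "interleaving_topology X = topology_generated_by {class_ball X P r | P r. P \<in> X \<and> 0 < r}"

lemma openin_interleaving_topology:
  assumes X: "X \<subseteq> iso_class ` {M. persistence_module M}"
  shows "openin (interleaving_topology X) U \<longleftrightarrow> U \<subseteq> X \<and> (\<forall>P\<in>U. \<exists>r>0. class_ball X P r \<subseteq> U)"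
proof -
  have self: "class_dist P P = 0" if "P \<in> X" for P
    using that X class_dist_iso_class pmod_iso_imp_interleaving_dist_0 pmod_iso_refl by fastforce
  have tri: "class_dist P R \<le> class_dist P Q + class_dist Q R" if "P \<in> X" "Q \<in> X" "R \<in> X" for P Q R
    using subsetD[OF X that(1)] subsetD[OF X that(2)] subsetD[OF X that(3)]
    by (auto simp: class_dist_iso_class intro: interleaving_dist_triangle)
  have "istopology (\<lambda>U. U \<subseteq> X \<and> (\<forall>P\<in>U. \<exists>r>0. class_ball X P r \<subseteq> U))" (is "istopology ?op")
    unfolding istopology_def
  proof (intro conjI allI impI)
    fix S T assume S: "?op S" and T: "?op T"
    show "S \<inter> T \<subseteq> X" using S by blast
    show "\<forall>P\<in>S \<inter> T. \<exists>r>0. class_ball X P r \<subseteq> S \<inter> T"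
    proof
      fix P assume "P \<in> S \<inter> T"
      then obtain r s where rs: "r > 0" "s > 0" "class_ball X P r \<subseteq> S" "class_ball X P s \<subseteq> T"
        using S T by blast
      have "class_ball X P (min r s) \<subseteq> class_ball X P r \<inter> class_ball X P s"
        using rs(1,2) by (auto simp: class_ball_def elim!: order.strict_trans2 intro!: ennreal_leI)
      then show "\<exists>r>0. class_ball X P r \<subseteq> S \<inter> T"
        using rs by (intro exI[of _ "min r s"]) auto
    qed
  next
    fix K assume "\<forall>S\<in>K. ?op S"
    then show "\<Union>K \<subseteq> X" "\<forall>P\<in>\<Union>K. \<exists>r>0. class_ball X P r \<subseteq> \<Union>K"
      by blast (meson Union_iff Union_upper \<open>\<forall>S\<in>K. ?op S\<close> order_trans)
  qed
  then have T: "openin (topology ?op) = ?op"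
    by (rule topology_inverse')
  have ball_open: "?op (class_ball X P r)" if "P \<in> X" for P r
  proof (intro conjI ballI)
    show "class_ball X P r \<subseteq> X" by (auto simp: class_ball_def)
    fix Q assume "Q \<in> class_ball X P r"
    then have Q: "Q \<in> X" "class_dist P Q < ennreal r" by (auto simp: class_ball_def)
    then obtain d where d: "d \<ge> 0" "class_dist P Q = ennreal d"
      by (cases "class_dist P Q") auto
    then have "d < r" using Q by (metis ennreal_less_iff)
    have "class_ball X Q (r - d) \<subseteq> class_ball X P r"
    proof
      fix R assume "R \<in> class_ball X Q (r - d)"
      then have R: "R \<in> X" "class_dist Q R < ennreal (r - d)" by (auto simp: class_ball_def)
      have "class_dist P R \<le> ennreal d + class_dist Q R"
        using tri[OF that Q(1) R(1)] d by simp
      also have "\<dots> < ennreal d + ennreal (r - d)"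
        using R(2) by (intro ennreal_add_left_cancel_less[THEN iffD2]) auto
      also have "\<dots> = ennreal r"
        using d \<open>d < r\<close> by (simp flip: ennreal_plus)
      finally show "R \<in> class_ball X P r" using R by (simp add: class_ball_def)
    qed
    then show "\<exists>s>0. class_ball X Q s \<subseteq> class_ball X P r"
      using \<open>d < r\<close> by (intro exI[of _ "r - d"]) auto
  qed
  have "?op U" if "openin (interleaving_topology X) U"
  proof -
    have "generate_topology_on {class_ball X P r | P r. P \<in> X \<and> 0 < r} U"
      using that by (simp add: interleaving_topology_def openin_topology_generated_by_iff)
    then have "openin (topology ?op) U"
    proof (induction rule: generate_topology_on.induct)
      case (Basis s)
      then show ?case using ball_open by (auto simp: T)
    qed auto
    then show ?thesis by (simp add: T)
  qed
  moreover have "openin (interleaving_topology X) U" if U: "?op U"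
  proof (subst openin_subopen, intro ballI)
    fix P assume P: "P \<in> U"
    then obtain r where r: "r > 0" "class_ball X P r \<subseteq> U" and "P \<in> X" using U by blast
    then have "openin (interleaving_topology X) (class_ball X P r)"
      unfolding interleaving_topology_def by (intro topology_generated_by_Basis) blast
    moreover have "P \<in> class_ball X P r"
      using r \<open>P \<in> X\<close> by (simp add: class_ball_def self)
    ultimately show "\<exists>T. openin (interleaving_topology X) T \<and> P \<in> T \<and> T \<subseteq> U"
      using r by blast
  qed
  ultimately show ?thesis by blast
qed

text \<open>
  Classes of direct sums of interval modules. Subsets \<open>A\<close> of \<open>\<real>\<close> serve as index sets: they realise
  exactly the cardinalities up to the continuum.
\<close>

definition interval_sums :: "(real set \<Rightarrow> (real \<Rightarrow> real set) \<Rightarrow> bool) \<Rightarrow> ('k::field) pclass set" where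
  "interval_sums P =
     {iso_class (direct_sum A (\<lambda>i. interval_module (J i))) | A J.
        (\<forall>i\<in>A. is_interval (J i) \<and> J i \<noteq> {}) \<and> P A J}"

definition fid :: "('k::field) pclass set" where
  "fid = interval_sums (\<lambda>A J. finite A)"

definition ffid :: "('k::field) pclass set" where
  "ffid = interval_sums (\<lambda>A J. finite A \<and> (\<forall>i\<in>A. bounded (J i)))"

definition ffid_on :: "real \<Rightarrow> real \<Rightarrow> ('k::field) pclass set" where
  "ffid_on c d =
     interval_sums (\<lambda>A J. finite A \<and> (\<forall>i\<in>A. bounded (J i) \<and> J i \<subseteq> {c..d}))"

definition cid :: "('k::field) pclass set" where
  "cid = interval_sums (\<lambda>A J. countable A)"

definition cfid :: "('k::field) pclass set" where
  "cfid = interval_sums (\<lambda>A J. countable A \<and> (\<forall>i\<in>A. bounded (J i)))"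

definition rid :: "('k::field) pclass set" where
  "rid = interval_sums (\<lambda>A J. True)"

definition pfd :: "('k::field) pclass set" where
  "pfd = {iso_class M | M. persistence_module M \<and> pointwise_finite_dim M}"


section \<open>Topological dimension\<close>

definition has_order :: "'a set \<Rightarrow> 'a set set \<Rightarrow> nat \<Rightarrow> bool" where
  "has_order X \<C> m \<longleftrightarrow>
     (\<exists>x\<in>X. \<exists>\<D>\<subseteq>\<C>. finite \<D> \<and> card \<D> = m \<and> x \<in> \<Inter>\<D>) \<and>
     \<not> (\<exists>x\<in>X. \<exists>\<D>\<subseteq>\<C>. finite \<D> \<and> card \<D> = m + 1 \<and> x \<in> \<Inter>\<D>)"

definition open_cover :: "'a topology \<Rightarrow> 'a set set \<Rightarrow> bool" where
  "open_cover X \<O> \<longleftrightarrow> (\<forall>U\<in>\<O>. openin X U) \<and> \<Union>\<O> = topspace X"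

definition open_refinement :: "'a topology \<Rightarrow> 'a set set \<Rightarrow> 'a set set \<Rightarrow> bool" where
  "open_refinement X \<V> \<O> \<longleftrightarrow> open_cover X \<V> \<and> (\<forall>V\<in>\<V>. \<exists>U\<in>\<O>. V \<subseteq> U)"

definition topological_dimension :: "'a topology \<Rightarrow> enat" where
  "topological_dimension X =
     Inf {enat m | m. \<forall>\<O>. open_cover X \<O> \<longrightarrow>
            (\<exists>\<V>. open_refinement X \<V> \<O> \<and> has_order (topspace X) \<V> (m + 1))}"

end

theory Submission
  imports Defs
begin

text \<open>
  Every one of the spaces contains, for each \<open>n\<close>, a copy of the cube \<open>[0, 1]\<^sup>n\<close>: cut \<open>[c, d]\<close> into
  \<open>n\<close> blocks of width \<open>4 h\<close> and put into the \<open>i\<close>-th block one bar that starts at the left end of the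
  block and has length \<open>h + h x\<^sub>i\<close>. Moving a point by at most \<open>\<delta>\<close> in every coordinate moves the module
  by at most \<open>h \<delta>\<close> (\<open>interleaving_dist_cube_module_le\<close>), so the copy is the image of a continuous map.
  Since the blocks are far apart compared with \<open>h\<close>, a bar of length \<open>2 h\<close> can only be matched with
  the bar in the same block, and points on opposite faces of the cube have distance at least \<open>h\<close>
  (\<open>interleaving_dist_cube_module_opposite_faces\<close>).

  Now cover the space by all balls of radius \<open>h / 2\<close>. A member of a refinement is contained in such
  a ball, so its preimage in the cube does not meet two opposite faces. By Lebesgue's covering
  theorem (\<open>lebesgue_covering\<close>), an open cover of the \<open>n\<close>-cube with this property has a point that
  lies in \<open>n + 1\<close> members. The cover and its refinements live on the whole space and are only pulled
  back to the cube, so the same argument serves all seven spaces at once. With \<open>n = m + 1\<close> it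
  contradicts an order of \<open>m + 1\<close>, for every \<open>m\<close>.

  Lebesgue's theorem itself is reduced to the theorem of Poincare and Miranda, which in turn follows
  from Kuhn's combinatorial lemma. The dimension \<open>n\<close> varies inside the statement, so the cube
  is a set of functions on the natural numbers with its dimension as a parameter, instead of a
  subset of a Euclidean space whose dimension is fixed by its type.
\<close>

section \<open>Lebesgue's covering theorem for the cube\<close>

text \<open>
  The coordinates beyond \<open>n\<close> are fixed at \<open>0\<close>, which makes the cube compact in the product topology
  on \<open>nat \<Rightarrow> real\<close>.
\<close>

definition cube :: "nat \<Rightarrow> (nat \<Rightarrow> real) set" where
  "cube n = {x. (\<forall>i<n. 0 \<le> x i \<and> x i \<le> 1) \<and> (\<forall>i\<ge>n. x i = 0)}"

lemma compact_cube: "compact (cube n)"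
proof -
  have "cube n = PiE UNIV (\<lambda>i. if i < n then {0..1} else {0})"
    by (auto simp: cube_def PiE_def Pi_def not_less split: if_splits)
  moreover have "compactin (product_topology (\<lambda>i. euclidean) (UNIV :: nat set))
      (PiE UNIV (\<lambda>i. if i < n then {0..1} else {0 :: real}))"
    unfolding compactin_PiE by simp
  ultimately show ?thesis
    by (simp add: euclidean_product_topology)
qed

lemma LIMSEQ_coordinatewise:
  fixes X :: "nat \<Rightarrow> nat \<Rightarrow> real"
  shows "X \<longlonglongrightarrow> x \<longleftrightarrow> (\<forall>i. (\<lambda>k. X k i) \<longlonglongrightarrow> x i)"
  using limitin_componentwise[of "\<lambda>i::nat. euclidean :: real topology" UNIV X x sequentially]
  by (simp add: euclidean_product_topology)

text \<open>
  The theorem of Poincare and Miranda. On a grid of mesh \<open>1 / p\<close>, label a vertex in direction \<open>i\<close> by the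
  sign of \<open>g i\<close>; Kuhn's lemma yields a cell in which both labels occur in every direction, that is,
  in which each \<open>g i\<close> takes a value \<open>\<ge> 0\<close> and a value \<open>\<le> 0\<close>. A limit point of such cells for
  \<open>p \<rightarrow> \<infinity>\<close> is a common zero.
\<close>

lemma poincare_miranda:
  fixes g :: "nat \<Rightarrow> (nat \<Rightarrow> real) \<Rightarrow> real"
  assumes cont: "\<And>i. i < n \<Longrightarrow> continuous_on (cube n) (g i)"
    and lo: "\<And>i x. i < n \<Longrightarrow> x \<in> cube n \<Longrightarrow> x i = 0 \<Longrightarrow> 0 \<le> g i x"
    and hi: "\<And>i x. i < n \<Longrightarrow> x \<in> cube n \<Longrightarrow> x i = 1 \<Longrightarrow> g i x \<le> 0"
  shows "\<exists>x\<in>cube n. \<forall>i<n. g i x = 0"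
proof -
  define pt where "pt p q = (\<lambda>i. if i < n then real (q i) / real p else 0)" for p :: nat and q :: "nat \<Rightarrow> nat"
  have pt_cube: "pt p q \<in> cube n" if "0 < p" "\<And>i. i < n \<Longrightarrow> q i \<le> p" for p q
    using that by (auto simp: pt_def cube_def)
  have grid: "\<exists>q r s. q \<in> cube n \<and> (\<forall>i<n. r i \<in> cube n \<and> s i \<in> cube n \<and> 0 \<le> g i (r i) \<and> g i (s i) \<le> 0
      \<and> (\<forall>j. \<bar>r i j - q j\<bar> \<le> inverse (real (Suc k)) \<and> \<bar>s i j - q j\<bar> \<le> inverse (real (Suc k))))" for k
  proof -
    let ?p = "Suc k"
    \<comment> \<open>The values of \<open>g\<close> on the faces have the right sign but may vanish, so there the label is
      prescribed; it still agrees with a weak sign of \<open>g\<close>.\<close>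
    define label :: "(nat \<Rightarrow> nat) \<Rightarrow> nat \<Rightarrow> nat" where
      "label q i = (if q i = 0 then 0 else if q i = ?p then 1 else if 0 \<le> g i (pt ?p q) then 0 else 1)" for q i
    obtain q where q: "\<forall>i<n. q i < ?p"
      and rs: "\<forall>i<n. \<exists>r s. (\<forall>j<n. q j \<le> r j \<and> r j \<le> q j + 1)
        \<and> (\<forall>j<n. q j \<le> s j \<and> s j \<le> q j + 1) \<and> label r i \<noteq> label s i"
    proof (rule kuhn_lemma[of ?p n label])
    qed (simp_all add: label_def)
    have two: "label r i = 0 \<or> label r i = 1" for r i
      by (simp add: label_def)
    have nonneg: "0 \<le> g i (pt ?p r)" if "i < n" "\<forall>j<n. r j \<le> ?p" "label r i = 0" for r i
      using that lo[of i "pt ?p r"] pt_cube[of ?p r] by (auto simp: label_def pt_def split: if_splits)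
    have nonpos: "g i (pt ?p r) \<le> 0" if "i < n" "\<forall>j<n. r j \<le> ?p" "label r i \<noteq> 0" for r i
      using that hi[of i "pt ?p r"] pt_cube[of ?p r] by (auto simp: label_def pt_def split: if_splits)
    have near: "\<bar>pt ?p r j - pt ?p q j\<bar> \<le> inverse (real ?p)" if "\<forall>j<n. q j \<le> r j \<and> r j \<le> q j + 1" for r j
    proof (cases "j < n")
      case True
      then have "\<bar>real (r j) - real (q j)\<bar> \<le> 1"
        using that by force
      then show ?thesis
        using True by (simp add: pt_def divide_simps flip: diff_divide_distrib)
    qed (simp add: pt_def)
    have cell: "\<forall>j<n. r j \<le> ?p" if "\<forall>j<n. q j \<le> r j \<and> r j \<le> q j + 1" for r
      using that q by force
    have "\<exists>r s. r \<in> cube n \<and> s \<in> cube n \<and> 0 \<le> g i r \<and> g i s \<le> 0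
      \<and> (\<forall>j. \<bar>r j - pt ?p q j\<bar> \<le> inverse (real ?p) \<and> \<bar>s j - pt ?p q j\<bar> \<le> inverse (real ?p))"
      if i: "i < n" for i
    proof -
      obtain r s where r: "\<forall>j<n. q j \<le> r j \<and> r j \<le> q j + 1"
        and s: "\<forall>j<n. q j \<le> s j \<and> s j \<le> q j + 1" and ne: "label r i \<noteq> label s i"
        using rs i by blast
      have in_cube: "pt ?p r \<in> cube n" "pt ?p s \<in> cube n"
        using cell[OF r] cell[OF s] by (auto intro: pt_cube)
      consider "label r i = 0" "label s i \<noteq> 0" | "label s i = 0" "label r i \<noteq> 0"
        using ne two by metis
      then show ?thesis
      proof cases
        case 1
        then show ?thesis
          using nonneg[OF i cell[OF r]] nonpos[OF i cell[OF s]] in_cube near[OF r] near[OF s] by blast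
      next
        case 2
        then show ?thesis
          using nonneg[OF i cell[OF s]] nonpos[OF i cell[OF r]] in_cube near[OF r] near[OF s] by blast
      qed
    qed
    moreover have "pt ?p q \<in> cube n"
      using q by (intro pt_cube) (auto simp: less_imp_le)
    ultimately show ?thesis
      by metis
  qed
  then obtain Q R S where Q: "\<And>k. Q k \<in> cube n"
    and RS: "\<And>k i. i < n \<Longrightarrow> R k i \<in> cube n \<and> S k i \<in> cube n \<and> 0 \<le> g i (R k i) \<and> g i (S k i) \<le> 0"
    and near: "\<And>k i j. i < n \<Longrightarrow> \<bar>R k i j - Q k j\<bar> \<le> inverse (real (Suc k)) \<and> \<bar>S k i j - Q k j\<bar> \<le> inverse (real (Suc k))"
    by metis
  obtain x \<sigma> where x: "x \<in> cube n" and \<sigma>: "strict_mono \<sigma>" and lim: "(Q \<circ> \<sigma>) \<longlonglongrightarrow> x"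
    using compact_cube[of n] Q unfolding compact_eq_seq_compact_metric seq_compact_def by metis
  have close: "(\<lambda>k. P (\<sigma> k)) \<longlonglongrightarrow> x" if P: "\<And>k j. \<bar>P k j - Q k j\<bar> \<le> inverse (real (Suc k))" for P
    unfolding LIMSEQ_coordinatewise
  proof
    fix j
    have inv: "(\<lambda>k. inverse (real (Suc (\<sigma> k)))) \<longlonglongrightarrow> 0"
      using LIMSEQ_subseq_LIMSEQ[OF LIMSEQ_inverse_real_of_nat \<sigma>] by (simp add: o_def)
    have "(\<lambda>k. P (\<sigma> k) j - Q (\<sigma> k) j) \<longlonglongrightarrow> 0"
      by (rule Lim_null_comparison[OF _ inv]) (use P in auto)
    moreover have "(\<lambda>k. Q (\<sigma> k) j) \<longlonglongrightarrow> x j"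
      using lim by (simp add: LIMSEQ_coordinatewise)
    ultimately show "(\<lambda>k. P (\<sigma> k) j) \<longlonglongrightarrow> x j"
      using tendsto_add by fastforce
  qed
  have "g i x = 0" if i: "i < n" for i
  proof (rule antisym)
    have "(\<lambda>k. g i (R (\<sigma> k) i)) \<longlonglongrightarrow> g i x"
      by (rule continuous_on_tendsto_compose[OF cont[OF i] close x]) (use near RS i in auto)
    then show "0 \<le> g i x"
      by (rule LIMSEQ_le_const) (use RS i in auto)
    have "(\<lambda>k. g i (S (\<sigma> k) i)) \<longlonglongrightarrow> g i x"
      by (rule continuous_on_tendsto_compose[OF cont[OF i] close x]) (use near RS i in auto)
    then show "g i x \<le> 0"
      by (rule LIMSEQ_le_const2) (use RS i in auto)
  qed
  then show ?thesis using x by blast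
qed

text \<open>
  Let \<open>f j\<close> be continuous and positive exactly on \<open>H j\<close>, and consider
  \<open>g i = f i - (f (i + 1) + \<dots> + f n)\<close>. On the face \<open>x i = 0\<close> the subtracted terms vanish, on the face
  \<open>x i = 1\<close> the first term does, so there is a common zero. At this point each \<open>f i\<close> with \<open>i < n\<close>
  is the sum of the later ones; hence all of them are positive multiples of \<open>f n\<close>, which is not \<open>0\<close>
  because the sets \<open>H j\<close> cover the cube.
\<close>

lemma ordered_cover_common_point:
  assumes op: "\<And>j. j \<le> n \<Longrightarrow> openin (top_of_set (cube n)) (H j)"
    and cover: "cube n \<subseteq> (\<Union>j\<le>n. H j)"
    and lo: "\<And>i j x. i < j \<Longrightarrow> j \<le> n \<Longrightarrow> x \<in> H j \<Longrightarrow> x i \<noteq> 0"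
    and hi: "\<And>i x. i < n \<Longrightarrow> x \<in> H i \<Longrightarrow> x i \<noteq> 1"
  shows "\<exists>x\<in>cube n. \<forall>j\<le>n. x \<in> H j"
proof -
  \<comment> \<open>A point outside the cube: the distance to the empty set is \<open>0\<close> by convention, so the complement
    of \<open>H j\<close> must be made nonempty when \<open>H j\<close> is the whole cube.\<close>
  let ?out = "(\<lambda>_. 2) :: nat \<Rightarrow> real"
  define f where "f j x = infdist x (insert ?out (cube n - H j))" for j x
  have out: "?out \<notin> cube n"
    by (auto simp: cube_def not_le intro!: exI[of _ n])
  have nonneg: "0 \<le> f j x" for j x
    by (simp add: f_def infdist_nonneg)
  have pos_iff: "0 < f j x \<longleftrightarrow> x \<in> H j" if j: "j \<le> n" and x: "x \<in> cube n" for j x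
  proof -
    have "openin (top_of_set (cube n)) (H j)" using op j by blast
    then have "closedin (top_of_set (cube n)) (cube n - H j)"
      using openin_closedin_eq[of "top_of_set (cube n)" "H j"] by simp
    then have "closed (insert ?out (cube n - H j))"
      using compact_imp_closed[OF compact_cube] by (meson closedin_closed_trans closed_insert)
    then have "f j x = 0 \<longleftrightarrow> x \<in> insert ?out (cube n - H j)"
      unfolding f_def by (subst in_closed_iff_infdist_zero) auto
    then show ?thesis
      using x out nonneg[of j x] by auto
  qed
  define g where "g i x = f i x - (\<Sum>j\<in>{i<..n}. f j x)" for i x
  have "\<exists>x\<in>cube n. \<forall>i<n. g i x = 0"
  proof (rule poincare_miranda)
    show "continuous_on (cube n) (g i)" for i
      unfolding g_def f_def by (intro continuous_intros)
  next
    fix i x assume i: "i < n" and x: "x \<in> cube n" "x i = 0"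
    have "f j x = 0" if "j \<in> {i<..n}" for j
      using pos_iff[of j x] lo[of i j x] nonneg[of j x] x that by fastforce
    then show "0 \<le> g i x"
      by (simp add: g_def nonneg)
  next
    fix i x assume i: "i < n" and x: "x \<in> cube n" "x i = 1"
    have "f i x = 0"
      using pos_iff[of i x] hi[of i x] nonneg[of i x] x i by fastforce
    then show "g i x \<le> 0"
      by (simp add: g_def nonneg sum_nonneg)
  qed
  then obtain x where x: "x \<in> cube n" and zero: "\<And>i. i < n \<Longrightarrow> f i x = (\<Sum>j\<in>{i<..n}. f j x)"
    by (auto simp: g_def)
  obtain l where l: "l \<le> n" "0 < f l x"
    using cover x pos_iff by blast
  have top: "0 < f n x"
  proof (rule ccontr)
    assume "\<not> 0 < f n x"
    then have n0: "f n x = 0" using nonneg[of n x] by simp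
    have "f i x = 0" if "i \<le> n" for i
      using that
    proof (induction "n - i" arbitrary: i rule: less_induct)
      case less
      show ?case
      proof (cases "i = n")
        case False
        then have "f i x = (\<Sum>j\<in>{i<..n}. f j x)" using zero less.prems by simp
        also have "\<dots> = 0" using less by (intro sum.neutral) auto
        finally show ?thesis .
      qed (use n0 in simp)
    qed
    then show False using l by auto
  qed
  have "0 < f j x" if "j \<le> n" for j
  proof (cases "j = n")
    case False
    then have "f n x \<le> (\<Sum>i\<in>{j<..n}. f i x)"
      using that nonneg by (intro member_le_sum) auto
    then show ?thesis using zero[of j] top False that by simp
  qed (use top in simp)
  then show ?thesis
    using x pos_iff by blast
qed

text \<open>
  Sort the members into \<open>n + 1\<close> classes by the first face \<open>x i = 0\<close> that they meet, with the class \<open>n\<close> for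
  those that meet none. The union of the class \<open>i < n\<close> misses the face \<open>x i = 1\<close>, and the unions of
  the later classes miss the face \<open>x i = 0\<close>. A point common to all \<open>n + 1\<close> unions lies in one member
  of each class. The family is indexed, so that members with equal sets count separately:
  this is what pulling back a cover requires.
\<close>

lemma lebesgue_covering:
  assumes op: "\<And>v. v \<in> I \<Longrightarrow> openin (top_of_set (cube n)) (G v)"
    and cover: "cube n \<subseteq> (\<Union>v\<in>I. G v)"
    and small: "\<And>v i x y. v \<in> I \<Longrightarrow> i < n \<Longrightarrow> x \<in> G v \<Longrightarrow> y \<in> G v \<Longrightarrow> x i = 0 \<Longrightarrow> y i \<noteq> 1"
  shows "\<exists>x\<in>cube n. \<exists>D\<subseteq>I. finite D \<and> card D = n + 1 \<and> (\<forall>v\<in>D. x \<in> G v)"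
proof -
  define \<kappa> where "\<kappa> v = (LEAST i. i = n \<or> (\<exists>x\<in>G v. x i = 0))" for v
  have \<kappa>: "\<kappa> v = n \<or> (\<exists>x\<in>G v. x (\<kappa> v) = 0)" for v
    unfolding \<kappa>_def by (rule LeastI[of _ n]) simp
  have \<kappa>_le: "\<kappa> v \<le> n" for v
    unfolding \<kappa>_def by (rule Least_le) simp
  have \<kappa>_min: "x i \<noteq> 0" if "i < \<kappa> v" "x \<in> G v" for i v x
    using not_less_Least[of i "\<lambda>i. i = n \<or> (\<exists>x\<in>G v. x i = 0)"] that unfolding \<kappa>_def by blast
  define H where "H j = (\<Union>v\<in>{v\<in>I. \<kappa> v = j}. G v)" for j
  have "\<exists>x\<in>cube n. \<forall>j\<le>n. x \<in> H j"
  proof (rule ordered_cover_common_point)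
    show "openin (top_of_set (cube n)) (H j)" for j
      unfolding H_def using op by blast
    show "cube n \<subseteq> (\<Union>j\<le>n. H j)"
    proof
      fix x assume "x \<in> cube n"
      then obtain v where "v \<in> I" "x \<in> G v" using cover by blast
      then show "x \<in> (\<Union>j\<le>n. H j)"
        using \<kappa>_le[of v] unfolding H_def by blast
    qed
    show "x i \<noteq> 0" if "i < j" "x \<in> H j" for i j x
      using that \<kappa>_min by (auto simp: H_def)
    show "x i \<noteq> 1" if "i < n" "x \<in> H i" for i x
    proof -
      obtain v where v: "v \<in> I" "\<kappa> v = i" "x \<in> G v"
        using \<open>x \<in> H i\<close> by (auto simp: H_def)
      then obtain y where "y \<in> G v" "y i = 0"
        using \<kappa>[of v] \<open>i < n\<close> by auto
      then show ?thesis
        using small v \<open>i < n\<close> by blast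
    qed
  qed
  then obtain x v where x: "x \<in> cube n" and v: "\<And>j. j \<le> n \<Longrightarrow> v j \<in> I \<and> \<kappa> (v j) = j \<and> x \<in> G (v j)"
    unfolding H_def by (simp add: Bex_def) metis
  have "inj_on v {..n}"
    by (rule inj_on_inverseI[of _ \<kappa>]) (use v in auto)
  then have "card (v ` {..n}) = n + 1"
    by (simp add: card_image)
  then show ?thesis
    using x v by (intro bexI[of _ x] exI[of _ "v ` {..n}"]) auto
qed

section \<open>Direct sums of interval modules\<close>


abbreviation interval_sum :: "'i set \<Rightarrow> ('i \<Rightarrow> real set) \<Rightarrow> ('k::field, 'i \<Rightarrow>\<^sub>0 'k) pmod" where
  "interval_sum A J \<equiv> direct_sum A (\<lambda>i. interval_module (J i))"

lemma lookup_scal_interval_sum: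
  "Poly_Mapping.lookup (scal (interval_sum A J) c f) i = c * Poly_Mapping.lookup f i"
  by (simp add: direct_sum_def interval_module_def lookup_mapp when_def in_keys_iff)

lemma lookup_tmap_interval_sum:
  "Poly_Mapping.lookup (tmap (interval_sum A J) a b f) i =
    (if a \<in> J i \<and> b \<in> J i then Poly_Mapping.lookup f i else 0)"
  by (simp add: direct_sum_def interval_module_def lookup_mapp when_def in_keys_iff)

lemma fiber_interval_sum_iff:
  "f \<in> fiber (interval_sum A J) a \<longleftrightarrow> (\<forall>i. Poly_Mapping.lookup f i \<noteq> 0 \<longrightarrow> i \<in> A \<and> a \<in> J i)"
  by (auto simp: direct_sum_def interval_module_def subset_iff in_keys_iff split: if_splits)

lemma vector_space_interval_sum: "vector_space (scal (interval_sum A J))"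
  by unfold_locales
    (auto intro!: poly_mapping_eqI simp: lookup_scal_interval_sum lookup_add algebra_simps)

lemma subspace_fiber_interval_sum:
  "module.subspace (scal (interval_sum A J)) (fiber (interval_sum A J :: ('k::field, 'i \<Rightarrow>\<^sub>0 'k) pmod) a)"
proof -
  have md: "module (scal (interval_sum A J :: ('k, 'i \<Rightarrow>\<^sub>0 'k) pmod))"
    using vector_space_interval_sum by (simp add: module_iff_vector_space)
  show ?thesis
    unfolding module.subspace_def[OF md]
  proof (intro conjI ballI allI)
    fix f g :: "'i \<Rightarrow>\<^sub>0 'k"
    assume "f \<in> fiber (interval_sum A J) a" "g \<in> fiber (interval_sum A J) a"
    moreover have "Poly_Mapping.lookup f i \<noteq> 0 \<or> Poly_Mapping.lookup g i \<noteq> 0"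
      if "Poly_Mapping.lookup (f + g) i \<noteq> 0" for i
      using that by (auto simp: lookup_add)
    ultimately show "f + g \<in> fiber (interval_sum A J) a"
      unfolding fiber_interval_sum_iff by blast
  qed (auto simp: fiber_interval_sum_iff lookup_scal_interval_sum)
qed

text \<open>
  The sets \<open>J i\<close> with \<open>i\<close> outside \<open>A\<close> are arbitrary here, as they are in \<open>interval_sums\<close>, so the
  summands are not all persistence modules and the general fact about direct sums does not apply.
\<close>

lemma persistence_module_interval_sum:
  assumes "\<And>i. i \<in> A \<Longrightarrow> is_interval (J i)"
  shows "persistence_module (interval_sum A J :: ('k::field, 'i \<Rightarrow>\<^sub>0 'k) pmod)" (is "persistence_module ?M")
proof -
  have md: "module (scal ?M)"
    using vector_space_interval_sum by (simp add: module_iff_vector_space)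
  have conv: "b \<in> J i" if "i \<in> A" "a \<in> J i" "c \<in> J i" "a \<le> b" "b \<le> c" for a b c i
    using assms[OF that(1)] that mem_is_interval_1_I by blast
  have "module.subspace (scal ?M) (fiber ?M a)" for a
    by (rule subspace_fiber_interval_sum)
  moreover have "linear_between (scal ?M) (fiber ?M a) (scal ?M) (fiber ?M b) (tmap ?M a b)" for a b
    unfolding linear_between_def
    by (auto intro!: poly_mapping_eqI
        simp: fiber_interval_sum_iff lookup_add lookup_scal_interval_sum lookup_tmap_interval_sum)
  moreover have "tmap ?M a a f = f" if "f \<in> fiber ?M a" for a f
    using that by (intro poly_mapping_eqI) (auto simp: fiber_interval_sum_iff lookup_tmap_interval_sum)
  moreover have "tmap ?M b c (tmap ?M a b f) = tmap ?M a c f"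
    if "f \<in> fiber ?M a" "a \<le> b" "b \<le> c" for a b c f
  proof (rule poly_mapping_eqI)
    fix i
    have "b \<in> J i" if nz: "Poly_Mapping.lookup f i \<noteq> 0" and "c \<in> J i"
    proof -
      have "i \<in> A" "a \<in> J i"
        using nz \<open>f \<in> fiber ?M a\<close> by (simp_all add: fiber_interval_sum_iff)
      then show ?thesis
        using conv \<open>c \<in> J i\<close> \<open>a \<le> b\<close> \<open>b \<le> c\<close> by blast
    qed
    then show "Poly_Mapping.lookup (tmap ?M b c (tmap ?M a b f)) i = Poly_Mapping.lookup (tmap ?M a c f) i"
      by (cases "Poly_Mapping.lookup f i = 0"; cases "c \<in> J i") (simp_all add: lookup_tmap_interval_sum)
  qed
  ultimately show ?thesis
    unfolding persistence_module_def using vector_space_interval_sum by blast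
qed

lemma pointwise_finite_dim_interval_sum:
  assumes "finite A"
  shows "pointwise_finite_dim (interval_sum A J :: ('k::field, 'i \<Rightarrow>\<^sub>0 'k) pmod)"
  unfolding pointwise_finite_dim_def
proof
  fix a
  let ?M = "interval_sum A J :: ('k, 'i \<Rightarrow>\<^sub>0 'k) pmod"
  let ?B = "(\<lambda>i. Poly_Mapping.single i (1::'k)) ` {i\<in>A. a \<in> J i}"
  have md: "module (scal ?M)"
    using vector_space_interval_sum by (simp add: module_iff_vector_space)
  have sub: "module.subspace (scal ?M) (fiber ?M a)"
    by (rule subspace_fiber_interval_sum)
  have "module.span (scal ?M) ?B \<subseteq> fiber ?M a"
    by (rule module.span_minimal[OF md _ sub])
       (auto simp: fiber_interval_sum_iff lookup_single when_def split: if_splits)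
  moreover have "f \<in> module.span (scal ?M) ?B" if f: "f \<in> fiber ?M a" for f
  proof -
    have "f = (\<Sum>i\<in>{i\<in>A. a \<in> J i}. scal ?M (Poly_Mapping.lookup f i) (Poly_Mapping.single i 1))"
    proof (rule poly_mapping_eqI)
      fix j
      have "(\<Sum>i\<in>{i\<in>A. a \<in> J i}. Poly_Mapping.lookup f i * (1 when i = j)) =
          (\<Sum>i\<in>{i\<in>A. a \<in> J i}. if i = j then Poly_Mapping.lookup f j else 0)"
        by (rule sum.cong) auto
      also have "\<dots> = Poly_Mapping.lookup f j"
        using assms f by (auto simp: fiber_interval_sum_iff)
      finally show "Poly_Mapping.lookup f j = Poly_Mapping.lookup
          (\<Sum>i\<in>{i\<in>A. a \<in> J i}. scal ?M (Poly_Mapping.lookup f i) (Poly_Mapping.single i 1)) j"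
        by (simp add: lookup_sum lookup_scal_interval_sum lookup_single)
    qed
    also have "\<dots> \<in> module.span (scal ?M) ?B"
      by (intro module.span_sum[OF md] module.span_scale[OF md] module.span_base[OF md]) blast
    finally show ?thesis .
  qed
  ultimately show "\<exists>B. finite B \<and> module.span (scal ?M) B = fiber ?M a"
    using assms by (intro exI[of _ ?B]) auto
qed

text \<open>
  On each summand take the identity wherever both bars are present and \<open>0\<close> elsewhere. This is
  natural because the shift by \<open>\<epsilon>\<close> moves neither end of the first bar below the corresponding end of the
  second one.
\<close>

lemma interleaved_interval_sums:
  assumes \<epsilon>: "0 \<le> \<epsilon>"
    and near: "\<And>i. i \<in> A \<Longrightarrow> \<bar>l i - l' i\<bar> \<le> \<epsilon> \<and> \<bar>u i - u' i\<bar> \<le> \<epsilon>"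
  shows "interleaved \<epsilon> (interval_sum A (\<lambda>i. {l i..u i}) :: ('k::field, 'i \<Rightarrow>\<^sub>0 'k) pmod)
    (interval_sum A (\<lambda>i. {l' i..u' i}))"
proof -
  define \<theta> :: "('i \<Rightarrow> real set) \<Rightarrow> ('i \<Rightarrow> real set) \<Rightarrow> real \<Rightarrow> ('i \<Rightarrow>\<^sub>0 'k) \<Rightarrow> ('i \<Rightarrow>\<^sub>0 'k)"
    where "\<theta> J J' a = Poly_Mapping.mapp (\<lambda>i x. if a \<in> J i \<and> a + \<epsilon> \<in> J' i then x else 0)" for J J' a
  have lookup: "Poly_Mapping.lookup (\<theta> J J' a f) i =
      (if a \<in> J i \<and> a + \<epsilon> \<in> J' i then Poly_Mapping.lookup f i else 0)" for J J' a f i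
    by (simp add: \<theta>_def lookup_mapp when_def in_keys_iff)
  have morph: "shift_morphism \<epsilon> (interval_sum A (\<lambda>i. {l i..u i}) :: ('k, 'i \<Rightarrow>\<^sub>0 'k) pmod)
      (interval_sum A (\<lambda>i. {l' i..u' i})) (\<theta> (\<lambda>i. {l i..u i}) (\<lambda>i. {l' i..u' i}))"
    if near: "\<And>i. i \<in> A \<Longrightarrow> \<bar>l i - l' i\<bar> \<le> \<epsilon> \<and> \<bar>u i - u' i\<bar> \<le> \<epsilon>" for l u l' u'
    unfolding shift_morphism_def
  proof (intro conjI allI impI ballI)
    fix a
    show "linear_between (scal (interval_sum A (\<lambda>i. {l i..u i})))
        (fiber (interval_sum A (\<lambda>i. {l i..u i})) a) (scal (interval_sum A (\<lambda>i. {l' i..u' i})))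
        (fiber (interval_sum A (\<lambda>i. {l' i..u' i})) (a + \<epsilon>)) (\<theta> (\<lambda>i. {l i..u i}) (\<lambda>i. {l' i..u' i}) a)"
      unfolding linear_between_def
      by (auto intro!: poly_mapping_eqI
          simp: fiber_interval_sum_iff lookup lookup_add lookup_scal_interval_sum split: if_splits)
  next
    fix a b :: real and f :: "'i \<Rightarrow>\<^sub>0 'k"
    assume ab: "a \<le> b" and f: "f \<in> fiber (interval_sum A (\<lambda>i. {l i..u i})) a"
    show "\<theta> (\<lambda>i. {l i..u i}) (\<lambda>i. {l' i..u' i}) b (tmap (interval_sum A (\<lambda>i. {l i..u i})) a b f) =
        tmap (interval_sum A (\<lambda>i. {l' i..u' i})) (a + \<epsilon>) (b + \<epsilon>)
          (\<theta> (\<lambda>i. {l i..u i}) (\<lambda>i. {l' i..u' i}) a f)"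
    proof (rule poly_mapping_eqI)
      fix i
      show "Poly_Mapping.lookup (\<theta> (\<lambda>i. {l i..u i}) (\<lambda>i. {l' i..u' i}) b
            (tmap (interval_sum A (\<lambda>i. {l i..u i})) a b f)) i =
          Poly_Mapping.lookup (tmap (interval_sum A (\<lambda>i. {l' i..u' i})) (a + \<epsilon>) (b + \<epsilon>)
            (\<theta> (\<lambda>i. {l i..u i}) (\<lambda>i. {l' i..u' i}) a f)) i"
      proof (cases "Poly_Mapping.lookup f i = 0")
        case False
        then have "i \<in> A" using f by (auto simp: fiber_interval_sum_iff)
        then show ?thesis
          using near[of i] ab by (auto simp: lookup lookup_tmap_interval_sum)
      qed (simp add: lookup lookup_tmap_interval_sum)
    qed
  qed
  have comp: "\<theta> (\<lambda>i. {l' i..u' i}) (\<lambda>i. {l i..u i}) (a + \<epsilon>) (\<theta> (\<lambda>i. {l i..u i}) (\<lambda>i. {l' i..u' i}) a f) =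
      tmap (interval_sum A (\<lambda>i. {l i..u i})) a (a + 2 * \<epsilon>) f"
    if near: "\<And>i. i \<in> A \<Longrightarrow> \<bar>l i - l' i\<bar> \<le> \<epsilon> \<and> \<bar>u i - u' i\<bar> \<le> \<epsilon>"
      and f: "f \<in> fiber (interval_sum A (\<lambda>i. {l i..u i})) a" for l u l' u' a and f :: "'i \<Rightarrow>\<^sub>0 'k"
  proof (rule poly_mapping_eqI)
    fix i
    show "Poly_Mapping.lookup (\<theta> (\<lambda>i. {l' i..u' i}) (\<lambda>i. {l i..u i}) (a + \<epsilon>)
          (\<theta> (\<lambda>i. {l i..u i}) (\<lambda>i. {l' i..u' i}) a f)) i =
        Poly_Mapping.lookup (tmap (interval_sum A (\<lambda>i. {l i..u i})) a (a + 2 * \<epsilon>) f) i"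
    proof (cases "Poly_Mapping.lookup f i = 0")
      case False
      then have "i \<in> A" using f by (auto simp: fiber_interval_sum_iff)
      then show ?thesis
        using near[of i] \<epsilon> by (auto simp: lookup lookup_tmap_interval_sum)
    qed (simp add: lookup lookup_tmap_interval_sum)
  qed
  have near': "\<And>i. i \<in> A \<Longrightarrow> \<bar>l' i - l i\<bar> \<le> \<epsilon> \<and> \<bar>u' i - u i\<bar> \<le> \<epsilon>"
    using near by (simp add: abs_minus_commute)
  show ?thesis
    unfolding interleaved_def
    using morph[of l l' u u'] morph[of l' l u' u] comp[of l l' u u'] comp[of l' l u' u] near near' by blast
qed

text \<open>
  Interleaved modules share their long-lived elements: \<open>M(s \<le> t)\<close> factors through
  \<open>N(s + \<epsilon> \<le> t - \<epsilon>)\<close>.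
\<close>

lemma interleaved_nonzero_map:
  assumes M: "persistence_module M" and N: "persistence_module N" and "interleaved \<epsilon> M N"
    and \<epsilon>: "0 \<le> \<epsilon>" and t: "s + 2 * \<epsilon> \<le> t" and x: "x \<in> fiber M s" and nz: "tmap M s t x \<noteq> 0"
  shows "\<exists>y\<in>fiber N (s + \<epsilon>). tmap N (s + \<epsilon>) (t - \<epsilon>) y \<noteq> 0"
proof -
  obtain f g where f: "shift_morphism \<epsilon> M N f" and g: "shift_morphism \<epsilon> N M g"
    and gf: "\<And>a x. x \<in> fiber M a \<Longrightarrow> g (a + \<epsilon>) (f a x) = tmap M a (a + 2 * \<epsilon>) x"
    using assms(3) unfolding interleaved_def by blast
  let ?y = "f s x"
  have y: "?y \<in> fiber N (s + \<epsilon>)"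
    by (rule shift_morphism_mem[OF f x])
  have "0 \<in> fiber N a" for a
  proof (rule module.subspace_0)
    show "module (scal N)" "module.subspace (scal N) (fiber N a)"
      using N by (simp_all add: persistence_module_def module_iff_vector_space)
  qed
  then have "g a (0 + 0) = g a 0 + g a 0" for a
    using g unfolding shift_morphism_def linear_between_def by blast
  then have g0: "g a 0 = 0" for a
    by simp
  have le: "s + \<epsilon> \<le> t - \<epsilon>"
    using t by simp
  have "g (t - \<epsilon>) (tmap N (s + \<epsilon>) (t - \<epsilon>) ?y) = tmap M (s + \<epsilon> + \<epsilon>) (t - \<epsilon> + \<epsilon>) (g (s + \<epsilon>) ?y)"
    using g le y unfolding shift_morphism_def by blast
  also have "\<dots> = tmap M (s + 2 * \<epsilon>) t (tmap M s (s + 2 * \<epsilon>) x)"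
    using gf[OF x] by (simp add: add.assoc)
  also have "\<dots> = tmap M s t x"
    using M t x \<epsilon> unfolding persistence_module_def by simp
  finally have "tmap N (s + \<epsilon>) (t - \<epsilon>) ?y \<noteq> 0"
    using nz g0 by auto
  then show ?thesis
    using y by blast
qed

lemma long_bar_has_partner:
  fixes J J' :: "'i \<Rightarrow> real set"
  assumes J: "\<And>i. i \<in> A \<Longrightarrow> is_interval (J i)" and J': "\<And>i. i \<in> A' \<Longrightarrow> is_interval (J' i)"
    and "interleaved \<epsilon> (interval_sum A J :: ('k::field, 'i \<Rightarrow>\<^sub>0 'k) pmod) (interval_sum A' J' :: ('k, 'i \<Rightarrow>\<^sub>0 'k) pmod)"
    and "0 \<le> \<epsilon>" "s + 2 * \<epsilon> \<le> t" and i: "i \<in> A" "s \<in> J i" "t \<in> J i"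
  shows "\<exists>j\<in>A'. s + \<epsilon> \<in> J' j \<and> t - \<epsilon> \<in> J' j"
proof -
  have "\<exists>y\<in>fiber (interval_sum A' J') (s + \<epsilon>). tmap (interval_sum A' J') (s + \<epsilon>) (t - \<epsilon>) y \<noteq> (0 :: 'i \<Rightarrow>\<^sub>0 'k)"
  proof (rule interleaved_nonzero_map)
    show "Poly_Mapping.single i 1 \<in> fiber (interval_sum A J :: ('k, 'i \<Rightarrow>\<^sub>0 'k) pmod) s"
      using i by (auto simp: fiber_interval_sum_iff lookup_single when_def split: if_splits)
    have "Poly_Mapping.lookup (tmap (interval_sum A J) s t (Poly_Mapping.single i (1::'k))) i \<noteq> 0"
      using i by (simp add: lookup_tmap_interval_sum)
    then show "tmap (interval_sum A J) s t (Poly_Mapping.single i (1::'k)) \<noteq> 0"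
      by auto
  qed (use assms persistence_module_interval_sum in blast)+
  then obtain y :: "'i \<Rightarrow>\<^sub>0 'k" where y: "y \<in> fiber (interval_sum A' J') (s + \<epsilon>)"
    and nz: "tmap (interval_sum A' J') (s + \<epsilon>) (t - \<epsilon>) y \<noteq> 0"
    by blast
  obtain j where "Poly_Mapping.lookup (tmap (interval_sum A' J') (s + \<epsilon>) (t - \<epsilon>) y) j \<noteq> 0"
    using nz poly_mapping_eqI[of _ "0 :: 'i \<Rightarrow>\<^sub>0 'k"] by auto
  with y show ?thesis
    by (auto simp: fiber_interval_sum_iff lookup_tmap_interval_sum split: if_splits)
qed

section \<open>Cubes of interval sums\<close>

text \<open>
  The index set of the sum has to consist of real numbers, so the \<open>i\<close>-th bar has the index \<open>real i\<close>,
  and \<open>nat \<lfloor>s\<rfloor>\<close> recovers \<open>i\<close> from it. The bars have lengths between \<open>h\<close> and \<open>2 h\<close> in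
  blocks of width \<open>4 h\<close>.
\<close>

definition bar :: "real \<Rightarrow> real \<Rightarrow> (nat \<Rightarrow> real) \<Rightarrow> real \<Rightarrow> real set" where
  "bar c h x s = {c + 4 * h * s .. c + 4 * h * s + h + h * x (nat \<lfloor>s\<rfloor>)}"

abbreviation cube_module :: "real \<Rightarrow> real \<Rightarrow> nat \<Rightarrow> (nat \<Rightarrow> real) \<Rightarrow> ('k::field, real \<Rightarrow>\<^sub>0 'k) pmod" where
  "cube_module c h n x \<equiv> interval_sum (real ` {..<n}) (bar c h x)"

lemma persistence_module_cube_module: "persistence_module (cube_module c h n x)"
  by (rule persistence_module_interval_sum) (simp add: bar_def)

lemma interleaving_dist_cube_module_le:
  assumes "0 < h" "0 \<le> \<delta>" and "\<And>i. i < n \<Longrightarrow> \<bar>x i - y i\<bar> \<le> \<delta>"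
  shows "interleaving_dist (cube_module c h n x :: ('k::field, real \<Rightarrow>\<^sub>0 'k) pmod) (cube_module c h n y)
    \<le> ennreal (h * \<delta>)"
proof -
  have "interleaved (h * \<delta>) (cube_module c h n x :: ('k, real \<Rightarrow>\<^sub>0 'k) pmod) (cube_module c h n y)"
    unfolding bar_def
  proof (rule interleaved_interval_sums)
    fix s assume "s \<in> real ` {..<n}"
    then obtain i where i: "s = real i" "i < n" by auto
    have "\<bar>h * x i - h * y i\<bar> = h * \<bar>x i - y i\<bar>"
      using \<open>0 < h\<close> by (simp add: abs_mult flip: right_diff_distrib)
    also have "\<dots> \<le> h * \<delta>"
      using assms i by simp
    finally show "\<bar>(c + 4 * h * s) - (c + 4 * h * s)\<bar> \<le> h * \<delta> \<and>
        \<bar>(c + 4 * h * s + h + h * x (nat \<lfloor>s\<rfloor>)) - (c + 4 * h * s + h + h * y (nat \<lfloor>s\<rfloor>))\<bar> \<le> h * \<delta>"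
      using assms i by simp
  qed (use assms in simp)
  then show ?thesis
    unfolding interleaving_dist_def using assms by (intro INF_lower) simp
qed

text \<open>
  In an \<open>\<epsilon>\<close>-interleaving with \<open>\<epsilon> < h\<close>, the bar of length \<open>2 h\<close> in the block \<open>i\<close> of the module at \<open>y\<close>
  forces some bar of the module at \<open>x\<close> to contain both of its ends moved inwards by \<open>\<epsilon>\<close>. The gaps between the
  bars leave only the one in the block \<open>i\<close>, which has length \<open>h\<close>, so it ends too early.
\<close>

lemma interleaving_dist_cube_module_opposite_faces:
  assumes h: "0 < h" and x: "x \<in> cube n" and i: "i < n" "x i = 0" "y i = 1"
  shows "ennreal h \<le> interleaving_dist (cube_module c h n y :: ('k::field, real \<Rightarrow>\<^sub>0 'k) pmod) (cube_module c h n x)"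
  unfolding interleaving_dist_def
proof (rule INF_greatest)
  fix \<epsilon>
  assume "\<epsilon> \<in> {\<epsilon>. 0 \<le> \<epsilon> \<and>
    interleaved \<epsilon> (cube_module c h n y :: ('k, real \<Rightarrow>\<^sub>0 'k) pmod) (cube_module c h n x :: ('k, real \<Rightarrow>\<^sub>0 'k) pmod)}"
  then have \<epsilon>: "0 \<le> \<epsilon>"
    and il: "interleaved \<epsilon> (cube_module c h n y :: ('k, real \<Rightarrow>\<^sub>0 'k) pmod) (cube_module c h n x :: ('k, real \<Rightarrow>\<^sub>0 'k) pmod)"
    by auto
  show "ennreal h \<le> ennreal \<epsilon>"
  proof (rule ccontr)
    assume "\<not> ?thesis"
    then have lt: "\<epsilon> < h"
      using ennreal_leI not_le by blast
    let ?s = "c + 4 * h * real i" and ?t = "c + 4 * h * real i + 2 * h"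
    have "\<exists>j\<in>real ` {..<n}. ?s + \<epsilon> \<in> bar c h x j \<and> ?t - \<epsilon> \<in> bar c h x j"
    proof (rule long_bar_has_partner[OF _ _ il \<epsilon>])
      show "real i \<in> real ` {..<n}" using i by simp
      show "?s \<in> bar c h y (real i)" "?t \<in> bar c h y (real i)" using i h by (auto simp: bar_def)
    qed (use lt in \<open>auto simp: bar_def\<close>)
    then obtain j where j: "j < n" and lo: "4 * h * real j \<le> 4 * h * real i + \<epsilon>"
      and hi: "4 * h * real i + 2 * h - \<epsilon> \<le> 4 * h * real j + h + h * x j"
      by (auto simp: bar_def)
    have "x j \<le> 1" using x j by (simp add: cube_def)
    then have xj: "h * x j \<le> h" using h by simp
    have "j = i"
    proof (rule ccontr)
      assume "j \<noteq> i"
      then consider "real j + 1 \<le> real i" | "real i + 1 \<le> real j"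
        by linarith
      then show False
      proof cases
        case 1
        then have "4 * h * (real j + 1) \<le> 4 * h * real i" using h by (intro mult_left_mono) auto
        then show False using hi xj lt h by (simp add: distrib_left)
      next
        case 2
        then have "4 * h * (real i + 1) \<le> 4 * h * real j" using h by (intro mult_left_mono) auto
        then show False using lo lt h by (simp add: distrib_left)
      qed
    qed
    then show False
      using hi i lt by simp
  qed
qed

section \<open>Covers by small balls\<close>

lemma class_dist_triangle:
  assumes "P \<in> iso_class ` {M. persistence_module M}" "Q \<in> iso_class ` {M. persistence_module M}"
    "R \<in> iso_class ` {M. persistence_module M}"
  shows "class_dist Q R \<le> class_dist P Q + class_dist P R"
proof -
  obtain L M N where "persistence_module L" "persistence_module M" "persistence_module N"
    and "P = iso_class L" "Q = iso_class M" "R = iso_class N"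
    using assms by blast
  then show ?thesis
    using interleaving_dist_triangle[of M N L] by (simp add: class_dist_iso_class interleaving_dist_sym[of M L])
qed

lemma topspace_interleaving_topology:
  assumes X: "X \<subseteq> iso_class ` {M. persistence_module M}"
  shows "topspace (interleaving_topology X) = X"
proof
  show "topspace (interleaving_topology X) \<subseteq> X"
    by (auto simp: interleaving_topology_def class_ball_def)
  have "openin (interleaving_topology X) X"
    unfolding openin_interleaving_topology[OF X] by (auto simp: class_ball_def intro: exI[of _ 1])
  then show "X \<subseteq> topspace (interleaving_topology X)"
    by (rule openin_subset)
qed

text \<open>
  The map \<open>\<Phi>\<close> is continuous, so a refinement pulls back to an open cover of the cube. A member of the
  refinement lies in a ball of radius \<open>h / 2\<close>, hence its preimage cannot contain points of two
  opposite faces, which are mapped to points at distance at least \<open>h\<close>, and \<open>lebesgue_covering\<close>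
  applies.
\<close>

lemma refinement_multiplicity:
  fixes \<Phi> :: "(nat \<Rightarrow> real) \<Rightarrow> ('k::field) pclass"
  assumes X: "X \<subseteq> iso_class ` {M. persistence_module M}" and h: "0 < h"
    and \<Phi>: "\<And>x. x \<in> cube n \<Longrightarrow> \<Phi> x \<in> X"
    and upper: "\<And>x y \<delta>. 0 \<le> \<delta> \<Longrightarrow> (\<And>i. i < n \<Longrightarrow> \<bar>x i - y i\<bar> \<le> \<delta>) \<Longrightarrow> class_dist (\<Phi> x) (\<Phi> y) \<le> ennreal (h * \<delta>)"
    and lower: "\<And>x y i. x \<in> cube n \<Longrightarrow> y \<in> cube n \<Longrightarrow> i < n \<Longrightarrow> x i = 0 \<Longrightarrow> y i = 1 \<Longrightarrow>
      ennreal h \<le> class_dist (\<Phi> y) (\<Phi> x)"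
    and \<V>: "open_refinement (interleaving_topology X) \<V> {class_ball X P (h / 2) | P. P \<in> X}"
  shows "\<exists>P\<in>X. \<exists>\<D>\<subseteq>\<V>. finite \<D> \<and> card \<D> = n + 1 \<and> P \<in> \<Inter>\<D>"
proof -
  have op: "openin (interleaving_topology X) v" if "v \<in> \<V>" for v
    using \<V> that by (simp add: open_refinement_def open_cover_def)
  have cover: "\<Union>\<V> = X"
    using \<V> topspace_interleaving_topology[OF X] by (simp add: open_refinement_def open_cover_def)
  let ?G = "\<lambda>v. {x \<in> cube n. \<Phi> x \<in> v}"
  have "\<exists>x\<in>cube n. \<exists>D\<subseteq>\<V>. finite D \<and> card D = n + 1 \<and> (\<forall>v\<in>D. x \<in> ?G v)"
  proof (rule lebesgue_covering)
    fix v assume v: "v \<in> \<V>"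
    show "openin (top_of_set (cube n)) (?G v)"
    proof (subst openin_subopen, intro ballI)
      fix x assume x: "x \<in> ?G v"
      then obtain r where r: "0 < r" "class_ball X (\<Phi> x) r \<subseteq> v"
        using op[OF v] unfolding openin_interleaving_topology[OF X] by blast
      define \<delta> where "\<delta> = r / (2 * h)"
      have \<delta>: "0 < \<delta>" "h * \<delta> < r"
        using r h by (auto simp: \<delta>_def)
      define W where "W = (\<Inter>i<n. {y :: nat \<Rightarrow> real. \<bar>x i - y i\<bar> < \<delta>})"
      have "open W"
        unfolding W_def by (intro open_INT ballI open_Collect_less continuous_intros) auto
      then have "openin (top_of_set (cube n)) (cube n \<inter> W)"
        by (rule openin_open_Int)
      moreover have "x \<in> cube n \<inter> W"
        using x \<delta> by (simp add: W_def)
      moreover have "cube n \<inter> W \<subseteq> ?G v"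
      proof
        fix y assume y: "y \<in> cube n \<inter> W"
        then have "class_dist (\<Phi> x) (\<Phi> y) \<le> ennreal (h * \<delta>)"
          using \<delta> by (intro upper) (auto simp: W_def less_imp_le)
        also have "\<dots> < ennreal r"
          using \<delta> h r by (simp add: ennreal_less_iff)
        finally have "\<Phi> y \<in> class_ball X (\<Phi> x) r"
          using y \<Phi> by (simp add: class_ball_def)
        then show "y \<in> ?G v"
          using y r by blast
      qed
      ultimately show "\<exists>T. openin (top_of_set (cube n)) T \<and> x \<in> T \<and> T \<subseteq> ?G v"
        by blast
    qed
  next
    show "cube n \<subseteq> (\<Union>v\<in>\<V>. ?G v)"
      using cover \<Phi> by blast
  next
    fix v i x y
    assume v: "v \<in> \<V>" and i: "i < n" and x: "x \<in> ?G v" and y: "y \<in> ?G v" and "x i = 0"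
    show "y i \<noteq> 1"
    proof
      assume "y i = 1"
      obtain P where P: "P \<in> X" "v \<subseteq> class_ball X P (h / 2)"
        using \<V> v unfolding open_refinement_def by blast
      have near: "class_dist P (\<Phi> z) < ennreal (h / 2)" if "z \<in> ?G v" for z
        using that P by (auto simp: class_ball_def)
      have "ennreal h \<le> class_dist (\<Phi> y) (\<Phi> x)"
        using lower x y i \<open>x i = 0\<close> \<open>y i = 1\<close> by blast
      also have "\<dots> \<le> class_dist P (\<Phi> y) + class_dist P (\<Phi> x)"
        using P \<Phi> X x y by (intro class_dist_triangle) auto
      also have "\<dots> < ennreal (h / 2) + ennreal (h / 2)"
        by (intro add_strict_mono near x y)
      also have "\<dots> = ennreal h"
        using h by (simp flip: ennreal_plus)
      finally show False by simp
    qed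
  qed
  then show ?thesis
    using \<Phi> by blast
qed

text \<open>
  For a given \<open>m\<close>, the cover that defeats order \<open>m + 1\<close> consists of balls whose radius is half the
  unit length \<open>h\<close> of the bars of the cube of dimension \<open>m + 1\<close>.
\<close>

lemma topological_dimension_infinite:
  fixes X :: "('k::field) pclass set"
  assumes X: "X \<subseteq> iso_class ` {M. persistence_module M}" and "c < d" and ffid: "ffid_on c d \<subseteq> X"
  shows "topological_dimension (interleaving_topology X) = \<infinity>"
proof -
  have "\<not> (\<forall>\<O>. open_cover (interleaving_topology X) \<O> \<longrightarrow>
      (\<exists>\<V>. open_refinement (interleaving_topology X) \<V> \<O> \<and>
        has_order (topspace (interleaving_topology X)) \<V> (m + 1)))" (is "\<not> ?dim") for m
  proof
    assume dim: ?dim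
    define n where "n = m + 1"
    define h where "h = (d - c) / (4 * real n)"
    have h: "0 < h"
      using \<open>c < d\<close> by (simp add: h_def n_def)
    have width: "c + 4 * h * real n = d"
    proof -
      have "h * (4 * real n) = d - c"
        by (simp add: h_def n_def)
      then show ?thesis by (simp add: algebra_simps)
    qed
    let ?\<O> = "{class_ball X P (h / 2) | P. P \<in> X}"
    have self: "P \<in> class_ball X P (h / 2)" if P: "P \<in> X" for P
    proof -
      obtain M where M: "persistence_module M" "P = iso_class M"
        using X P by blast
      then have "class_dist P P = 0"
        using class_dist_iso_class pmod_iso_imp_interleaving_dist_0 pmod_iso_refl by metis
      then show ?thesis
        using P h by (simp add: class_ball_def)
    qed
    have "openin (interleaving_topology X) (class_ball X P (h / 2))" if "P \<in> X" for P
      unfolding interleaving_topology_def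
      using that h by (intro topology_generated_by_Basis CollectI exI[of _ P] exI[of _ "h / 2"]) simp
    moreover have "\<Union>?\<O> = X"
      using self by (auto simp: class_ball_def)
    ultimately have "open_cover (interleaving_topology X) ?\<O>"
      unfolding open_cover_def topspace_interleaving_topology[OF X] by blast
    then obtain \<V> where \<V>: "open_refinement (interleaving_topology X) \<V> ?\<O>"
      and ord: "has_order X \<V> (m + 1)"
      using dim unfolding topspace_interleaving_topology[OF X] by blast
    let ?\<Phi> = "\<lambda>x. iso_class (cube_module c h n x) :: 'k pclass"
    have "\<exists>P\<in>X. \<exists>\<D>\<subseteq>\<V>. finite \<D> \<and> card \<D> = n + 1 \<and> P \<in> \<Inter>\<D>"
    proof (rule refinement_multiplicity[OF X h, where \<Phi> = ?\<Phi>])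
      fix x assume x: "x \<in> cube n"
      have "is_interval (bar c h x s) \<and> bar c h x s \<noteq> {} \<and> bounded (bar c h x s) \<and> bar c h x s \<subseteq> {c..d}"
        if s: "s \<in> real ` {..<n}" for s
      proof -
        obtain i where i: "s = real i" "i < n" using s by auto
        have "0 \<le> h * x i" "h * x i \<le> h" "0 \<le> 4 * h * real i"
          using x i h by (auto simp: cube_def)
        moreover have "4 * h * (real i + 1) \<le> 4 * h * real n"
          using i h by (intro mult_left_mono) auto
        then have "4 * h * real i + 4 * h \<le> 4 * h * real n"
          by (simp add: distrib_left)
        moreover have fl: "nat \<lfloor>s\<rfloor> = i"
          by (simp add: i)
        ultimately have "c \<le> c + 4 * h * s" "c + 4 * h * s \<le> c + 4 * h * s + h + h * x (nat \<lfloor>s\<rfloor>)"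
          "c + 4 * h * s + h + h * x (nat \<lfloor>s\<rfloor>) \<le> d"
          using h width unfolding fl unfolding i(1) by linarith+
        then show ?thesis
          unfolding bar_def by simp
      qed
      then have "?\<Phi> x \<in> ffid_on c d"
        unfolding ffid_on_def interval_sums_def
        by (intro CollectI exI[of _ "real ` {..<n}"] exI[of _ "bar c h x"]) simp
      then show "?\<Phi> x \<in> X" using ffid by blast
    next
      fix x y :: "nat \<Rightarrow> real" and \<delta> :: real
      assume "0 \<le> \<delta>" "\<And>i. i < n \<Longrightarrow> \<bar>x i - y i\<bar> \<le> \<delta>"
      then show "class_dist (?\<Phi> x) (?\<Phi> y) \<le> ennreal (h * \<delta>)"
        by (simp add: class_dist_iso_class persistence_module_cube_module interleaving_dist_cube_module_le h)
    next
      fix x y :: "nat \<Rightarrow> real" and i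
      assume "x \<in> cube n" "y \<in> cube n" "i < n" "x i = 0" "y i = 1"
      then show "ennreal h \<le> class_dist (?\<Phi> y) (?\<Phi> x)"
        by (simp add: class_dist_iso_class persistence_module_cube_module
            interleaving_dist_cube_module_opposite_faces h)
    qed (rule \<V>)
    then show False
      using ord unfolding has_order_def n_def by blast
  qed
  then have none: "{enat m | m. \<forall>\<O>. open_cover (interleaving_topology X) \<O> \<longrightarrow>
      (\<exists>\<V>. open_refinement (interleaving_topology X) \<V> \<O> \<and>
        has_order (topspace (interleaving_topology X)) \<V> (m + 1))} = {}"
    by blast
  show ?thesis
    unfolding topological_dimension_def none by (simp add: top_enat_def)
qed

lemma interval_sums_persistence_modules:
  "interval_sums P \<subseteq> iso_class ` {M. persistence_module M}"
  unfolding interval_sums_def using persistence_module_interval_sum by fast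

lemma interval_sums_mono:
  assumes "\<And>A J. P A J \<Longrightarrow> Q A J"
  shows "interval_sums P \<subseteq> interval_sums Q"
  unfolding interval_sums_def using assms by blast

lemma ffid_on_subset_pfd: "(ffid_on c d :: ('k::field) pclass set) \<subseteq> pfd"
proof
  fix P :: "'k pclass" assume "P \<in> ffid_on c d"
  then obtain A J where P: "P = iso_class (interval_sum A J)" and "finite A" "\<forall>i\<in>A. is_interval (J i)"
    by (auto simp: ffid_on_def interval_sums_def)
  then have "persistence_module (interval_sum A J :: ('k, real \<Rightarrow>\<^sub>0 'k) pmod)"
    and "pointwise_finite_dim (interval_sum A J :: ('k, real \<Rightarrow>\<^sub>0 'k) pmod)"
    by (simp_all add: persistence_module_interval_sum pointwise_finite_dim_interval_sum)
  then show "P \<in> pfd"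
    unfolding pfd_def P by (intro CollectI exI[of _ "interval_sum A J"] conjI refl)
qed

theorem corollary4p38:
  fixes c d :: real
  assumes "c < d"
  shows "topological_dimension (interleaving_topology (ffid_on c d :: ('k::field) pclass set)) = \<infinity>
    \<and> topological_dimension (interleaving_topology (ffid :: 'k pclass set)) = \<infinity>
    \<and> topological_dimension (interleaving_topology (fid :: 'k pclass set)) = \<infinity>
    \<and> topological_dimension (interleaving_topology (cfid :: 'k pclass set)) = \<infinity>
    \<and> topological_dimension (interleaving_topology (cid :: 'k pclass set)) = \<infinity>
    \<and> topological_dimension (interleaving_topology (pfd :: 'k pclass set)) = \<infinity>
    \<and> topological_dimension (interleaving_topology (rid :: 'k pclass set)) = \<infinity>"
proof -
  have sums: "topological_dimension (interleaving_topology (interval_sums P :: 'k pclass set)) = \<infinity>"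
    if "\<And>A J. finite A \<and> (\<forall>i\<in>A. bounded (J i) \<and> J i \<subseteq> {c..d}) \<Longrightarrow> P A J" for P
    by (rule topological_dimension_infinite[OF interval_sums_persistence_modules assms])
       (unfold ffid_on_def, rule interval_sums_mono, rule that)
  have "topological_dimension (interleaving_topology (pfd :: 'k pclass set)) = \<infinity>"
    by (rule topological_dimension_infinite[OF _ assms ffid_on_subset_pfd]) (auto simp: pfd_def)
  then show ?thesis
    unfolding ffid_on_def ffid_def fid_def cfid_def cid_def rid_def
    by (intro conjI sums) (auto intro: countable_finite)
qed

end
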